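(* Let $c_{t_0}\in P$ be any initial noncommutative metric at an initial time $t_0\in\mathbb{R}$. Then the noncommutative Ricci flow equation \[ \frac{d}{dt}c(t) = -\triangle \log c(t) \] has a unique $C^1$ solution $c$ with values in $P$ and $c(t_0)=c_{t_0}$ on any interval $[t_0,t_1]$ with $t_1\ge t_0$, and also on $[t_0,\infty)$. Moreover, such a solution is necessarily analytic: for every $t_2\in[t_0,\infty)$ there exists $\varepsilon>0$ such that each entry of the matrix $c(t)$ is given by a convergent power series in $t-t_2$ for all $t\in[t_0,\infty)\cap(t_2-\varepsilon,t_2+\varepsilon)$.
   Context: Fix integers $n\ge 2$ and $m\in\{1,\dots,n-1\}$ with $\gcd(m,n)=1$, and put $q=e^{2\pi i m/n}$. Let $A=M_n$ be the algebra of complex $n\times n$ matrices with the conjugate-transpose involution $a\mapsto a^*$, unit $I$, and usual trace $\tau$. Let $u,v\in A$ be unitary matrices generating $A$ with $vu=quv$ (for example $u=\mathrm{diag}(1,q,\dots,q^{n-1})$ and $v$ the cyclic shift matrix with $v_{k,k+1}=1$ for $k=1,\dots,n-1$, $v_{n,1}=1$, and all other entries $0$). Choose Hermitian matrices $x,y$ with $u=e^{2\pi i x/n}$ and $v=e^{2\pi i y/n}$, and define derivations $\delta_1=[y,\cdot\,]$, $\delta_2=-[x,\cdot\,]$ on $A$. The (flat) Laplacian is the linear operator $\triangle=\delta_1^2+\delta_2^2$ on $A$, i.e. $\triangle a=[y,[y,a]]+[x,[x,a]]$. Let $P=\{a\in A: a \text{ Hermitian with all eigenvalues strictly positive}\}$;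 an element $c\in P$ is called a noncommutative metric. For $a\in P$, $\log a$ is defined by diagonalizing $a$ unitarily and applying the real logarithm to the eigenvalues. A $C^1$ function means differentiable with continuous derivative (entrywise). *)

theory Defs
  imports "HOL-Analysis.Analysis"
begin

definition cscale :: "complex \<Rightarrow> complex^'n^'n \<Rightarrow> complex^'n^'n" where
  "cscale c A = (\<chi> i j. c * A $ i $ j)"

definition adj :: "complex^'n^'n \<Rightarrow> complex^'n^'n" where
  "adj A = (\<chi> i j. cnj (A $ j $ i))"

definition unitary :: "complex^'n^'n \<Rightarrow> bool" where
  "unitary U \<longleftrightarrow> U ** adj U = mat 1 \<and> adj U ** U = mat 1"

definition hermitian :: "complex^'n^'n \<Rightarrow> bool" where
  "hermitian A \<longleftrightarrow> adj A = A"

definition diagm :: "('n \<Rightarrow> complex) \<Rightarrow> complex^'n^'n" where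
  "diagm d = (\<chi> i j. if i = j then d i else 0)"

definition is_eigenvalue :: "complex^'n^'n \<Rightarrow> complex \<Rightarrow> bool" where
  "is_eigenvalue A e \<longleftrightarrow> (\<exists>w. w \<noteq> 0 \<and> A *v w = e *s w)"

definition posdef_set :: "(complex^'n^'n) set" where
  "posdef_set = {A. hermitian A \<and>
      (\<forall>e. is_eigenvalue A e \<longrightarrow> e \<in> \<real> \<and> Re e > 0)}"

primrec mpow :: "complex^'n^'n \<Rightarrow> nat \<Rightarrow> complex^'n^'n" where
  "mpow A 0 = mat 1"
| "mpow A (Suc k) = A ** mpow A k"

definition mexp :: "complex^'n^'n \<Rightarrow> complex^'n^'n" where
  "mexp A = (\<Sum>k. inverse (fact k) *\<^sub>R mpow A k)"

definition mlog :: "complex^'n^'n \<Rightarrow> complex^'n^'n" where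
  "mlog A = (THE B. \<exists>U d. unitary U \<and>
       A = U ** diagm (\<lambda>i. complex_of_real (d i)) ** adj U \<and>
       B = U ** diagm (\<lambda>i. complex_of_real (ln (d i))) ** adj U)"

definition generates :: "complex^'n^'n \<Rightarrow> complex^'n^'n \<Rightarrow> bool" where
  "generates u v \<longleftrightarrow> (\<forall>S. mat 1 \<in> S \<and> u \<in> S \<and> v \<in> S \<and>
      (\<forall>a\<in>S. \<forall>b\<in>S. a + b \<in> S \<and> a ** b \<in> S) \<and>
      (\<forall>c. \<forall>a\<in>S. cscale c a \<in> S) \<and> (\<forall>a\<in>S. adj a \<in> S)
      \<longrightarrow> S = UNIV)"

definition commut :: "complex^'n^'n \<Rightarrow> complex^'n^'n \<Rightarrow> complex^'n^'n" where
  "commut a b = a ** b - b ** a"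

definition delta1 :: "complex^'n^'n \<Rightarrow> complex^'n^'n \<Rightarrow> complex^'n^'n" where
  "delta1 y a = commut y a"

definition delta2 :: "complex^'n^'n \<Rightarrow> complex^'n^'n \<Rightarrow> complex^'n^'n" where
  "delta2 x a = - commut x a"

definition lap :: "complex^'n^'n \<Rightarrow> complex^'n^'n \<Rightarrow> complex^'n^'n \<Rightarrow> complex^'n^'n" where
  "lap x y a = delta1 y (delta1 y a) + delta2 x (delta2 x a)"

definition ricci_sol ::
  "complex^'n^'n \<Rightarrow> complex^'n^'n \<Rightarrow> real \<Rightarrow> real set \<Rightarrow> complex^'n^'n
     \<Rightarrow> (real \<Rightarrow> complex^'n^'n) \<Rightarrow> bool" where
  "ricci_sol x y t0 S c0 c \<longleftrightarrow>
     c t0 = c0 \<and> (\<forall>t\<in>S. c t \<in> posdef_set) \<and>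
     (\<exists>c'. (\<forall>i j. continuous_on S (\<lambda>t. c' t $ i $ j)) \<and>
           (\<forall>t\<in>S. \<forall>i j. ((\<lambda>s. c s $ i $ j) has_vector_derivative (c' t $ i $ j)) (at t within S)) \<and>
           (\<forall>t\<in>S. c' t = - lap x y (mlog (c t))))"

end

theory Submission
  imports Defs "HOL-Complex_Analysis.Cauchy_Integral_Formula"
begin

text \<open>Testing the equation with the identity shows that the trace T of c is conserved. In the coordinate
  X = I - c / T the equation reads X' = -(1/T) lap (X + X^2/2 + X^3/3 + ...), with X Hermitian and
  eigenvalues in [0,1). The derivative of tr (X^k) is a negative multiple of a sum of terms
  |y_ij|^2 (f(a_i) - f(a_j)) (g(a_i) - g(a_j)) with f and g increasing on the spectrum of X, so these
  traces do not increase; for large k this keeps the spectrum of X below some r < 1 for all time.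
  Picard iteration in complex time gives a holomorphic local solution whose radius depends only
  on r. Continuation then yields global existence, Gronwall's inequality yields uniqueness, and
  every solution agrees near each time with a holomorphic one.\<close>

section \<open>Diagonalization of Hermitian matrices\<close>

text \<open>The obstacle is the boundary of the positive cone, where the logarithm is singular:
  local existence alone gives time steps that may shrink as an eigenvalue of \<open>c\<close>
  approaches 0. A lower bound on the spectrum, uniform in time, makes all steps equally long. The
  smallest eigenvalue of \<open>c\<close> need not depend differentiably on time, whereas tr (X^k)
  does, and its k-th root dominates the largest eigenvalue of X; hence the detour through traces of
  powers. The scaling by T is dictated by the logarithm series: the eigenvalues of \<open>c\<close>
  are positive and sum to T, so those of c / T lie in (0,1] and the spectrum of I - c / T falls
  inside the disc of convergence. The matrix \<open>ln T *\<^sub>R mat 1\<close> that the scaling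
  adds to the logarithm is annihilated by \<open>lap\<close>. The series also supplies what the
  definition of \<open>mlog\<close> by diagonalization does not show: it is Lipschitz and
  holomorphic, and it makes sense for non-Hermitian matrices, which appear as soon as time is
  complex.\<close>

interpretation matmul: bounded_bilinear
  "(**) :: complex^'n^'n \<Rightarrow> complex^'n^'n \<Rightarrow> complex^'n^'n"
proof -
  have "bilinear ((**) :: complex^'n^'n \<Rightarrow> complex^'n^'n \<Rightarrow> complex^'n^'n)"
    unfolding bilinear_def
    by (auto intro!: linearI simp: matrix_add_ldistrib matrix_scalar_ac scalar_matrix_assoc
        vec_eq_iff matrix_matrix_mult_def distrib_right distrib_left sum.distrib scaleR_sum_right)
  then show "bounded_bilinear ((**) :: complex^'n^'n \<Rightarrow> complex^'n^'n \<Rightarrow> complex^'n^'n)"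
    by (simp add: bilinear_conv_bounded_bilinear)
qed

interpretation matvec: bounded_bilinear
  "(*v) :: complex^'n^'n \<Rightarrow> complex^'n \<Rightarrow> complex^'n"
proof -
  have "bilinear ((*v) :: complex^'n^'n \<Rightarrow> complex^'n \<Rightarrow> complex^'n)"
    unfolding bilinear_def
    by (auto intro!: linearI simp: vec_eq_iff matrix_vector_mult_def distrib_right distrib_left
        sum.distrib scaleR_sum_right)
  then show "bounded_bilinear ((*v) :: complex^'n^'n \<Rightarrow> complex^'n \<Rightarrow> complex^'n)"
    by (simp add: bilinear_conv_bounded_bilinear)
qed

lemma matrix_vector_axis: "(A *v axis j 1) $ i = A $ i $ j" for A :: "complex^'n^'m"
  by (simp add: matrix_vector_mult_def axis_def mult_delta_right)

lemma adj_adj [simp]: "adj (adj A) = A"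
  by (simp add: adj_def vec_eq_iff)

lemma adj_add: "adj (A + B) = adj A + adj B"
  by (simp add: adj_def vec_eq_iff)

lemma adj_diff: "adj (A - B) = adj A - adj B"
  by (simp add: adj_def vec_eq_iff)

lemma adj_scaleR: "adj (r *\<^sub>R A) = r *\<^sub>R adj A"
  by (simp add: adj_def vec_eq_iff)

lemma adj_mult: "adj (A ** B) = adj B ** adj A"
  by (simp add: adj_def vec_eq_iff matrix_matrix_mult_def mult.commute)

lemma adj_one [simp]: "adj (mat 1) = mat 1"
  by (auto simp: adj_def vec_eq_iff mat_def)

lemma norm_adj: "norm (adj A) = norm (A :: complex^'n^'n)"
proof -
  have "(norm (adj A))\<^sup>2 = (norm A)\<^sup>2"
    unfolding norm_vec_def L2_set_def adj_def
    by (simp add: sum_nonneg) (rule sum.swap)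
  then show ?thesis
    by (metis abs_norm_cancel real_sqrt_abs)
qed

lemma bounded_linear_adj: "bounded_linear (adj :: complex^'n^'n \<Rightarrow> _)"
  by (auto intro!: bounded_linear_intro[of _ 1] simp: adj_add adj_scaleR norm_adj)

lemma inner_complex_vec: "a \<bullet> b = Re (\<Sum>i\<in>UNIV. cnj (a $ i) * b $ i)"
  for a b :: "complex^'n"
  by (simp add: inner_vec_def inner_complex_def)

text \<open>The inner product of \<open>complex^'n\<close> is real, the real part of the Hermitian
  product. Orthogonality to both \<open>a\<close> and \<open>\<i> *s a\<close> is therefore the same
  as orthogonality in the Hermitian sense.\<close>

lemma inner_imult_complex_vec: "(\<i> *s a) \<bullet> b = Im (\<Sum>i\<in>UNIV. cnj (a $ i) * b $ i)"
  for a b :: "complex^'n"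
  by (simp add: inner_vec_def inner_complex_def algebra_simps)

lemma sesquilinear_adj:
  "(\<Sum>i\<in>UNIV. cnj ((A *v a) $ i) * b $ i) = (\<Sum>i\<in>UNIV. cnj (a $ i) * (adj A *v b) $ i)"
  for a b :: "complex^'n"
  by (simp add: matrix_vector_mult_def adj_def sum_distrib_left sum_distrib_right mult_ac)
    (rule sum.swap)

lemma inner_adj: "(A *v a) \<bullet> b = a \<bullet> (adj A *v b)"
  by (simp only: inner_complex_vec sesquilinear_adj)

lemma inner_hermitian: "hermitian A \<Longrightarrow> (A *v a) \<bullet> b = a \<bullet> (A *v b)"
  by (simp add: inner_adj hermitian_def)

lemma norm_unitary: "unitary U \<Longrightarrow> norm (U *v w) = norm w"
  by (simp add: norm_eq_sqrt_inner inner_adj matrix_vector_mul_assoc unitary_def)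

lemma unitary_adj: "unitary U \<Longrightarrow> unitary (adj U)"
  by (simp add: unitary_def)

text \<open>The eigenvector is a maximizer of the Rayleigh quotient on the unit sphere of the
  orthogonal complement of \<open>B\<close>. Only real eigenvalues occur, so everything can be done
  with the real inner product and the real dimension.\<close>

lemma hermitian_eigenvector_exists:
  fixes A :: "complex^'n^'n" and B :: "(complex^'n) set"
  assumes A: "hermitian A" and B: "dim B < DIM(complex^'n)"
    and inv: "\<And>b. b \<in> B \<Longrightarrow> \<exists>\<mu>. A *v b = \<mu> *\<^sub>R b"
  obtains w \<mu> where "norm w = 1" "A *v w = \<mu> *\<^sub>R w" "\<And>b. b \<in> B \<Longrightarrow> b \<bullet> w = 0"
proof -
  define W where "W = {w. \<forall>b\<in>B. b \<bullet> w = 0}"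
  define q where "q w = w \<bullet> (A *v w)" for w
  obtain w0 :: "complex^'n" where "w0 \<noteq> 0" and "\<And>b. b \<in> span B \<Longrightarrow> orthogonal w0 b"
    using orthogonal_to_subspace_exists[OF B] by blast
  then have "w0 \<in> W"
    by (auto simp: W_def orthogonal_def inner_commute span_base)
  have "closed W"
  proof -
    have "W = (\<Inter>b\<in>B. {w. b \<bullet> w = 0})" by (auto simp: W_def)
    then show ?thesis by (auto intro: closed_hyperplane)
  qed
  then have "compact (sphere 0 1 \<inter> W)"
    by (intro compact_Int_closed compact_sphere)
  moreover have "(1 / norm w0) *\<^sub>R w0 \<in> sphere 0 1 \<inter> W"
    using \<open>w0 \<in> W\<close> \<open>w0 \<noteq> 0\<close> by (auto simp: W_def)
  then have "sphere 0 1 \<inter> W \<noteq> {}" by blast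
  moreover have "continuous_on (sphere 0 1 \<inter> W) q"
    unfolding q_def by (intro continuous_intros matvec.continuous_on)
  ultimately obtain w where w: "w \<in> sphere 0 1 \<inter> W"
    and max: "\<And>z. z \<in> sphere 0 1 \<inter> W \<Longrightarrow> q z \<le> q w"
    using continuous_attains_sup by metis
  have q_le: "q z \<le> q w * (norm z)\<^sup>2" if "z \<in> W" for z
  proof (cases "z = 0")
    case False
    then have "(1 / norm z) *\<^sub>R z \<in> sphere 0 1 \<inter> W"
      using that by (auto simp: W_def)
    from max[OF this] False show ?thesis
      by (simp add: q_def matvec.scaleR_right power2_eq_square field_simps)
  qed (simp add: q_def)
  \<comment> \<open>Half the gradient of the Rayleigh quotient at \<open>w\<close>. It stays in
    \<open>W\<close> because \<open>A\<close> is symmetric and maps each \<open>b\<close> to a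
    multiple of itself, so \<open>w\<close> may be varied in this direction.\<close>
  define v where "v = A *v w - q w *\<^sub>R w"
  have "v \<in> W"
  proof -
    have "b \<bullet> v = 0" if "b \<in> B" for b
      using inv[OF that] w that inner_hermitian[OF A, of b w]
      by (auto simp: W_def v_def inner_diff_right)
    then show ?thesis by (simp add: W_def)
  qed
  have ww: "w \<bullet> w = 1" using w by (simp add: dot_square_norm)
  have vw: "v \<bullet> w = 0"
    by (simp add: v_def inner_diff_left ww q_def inner_commute[of "A *v w"])
  have vA: "v \<bullet> (A *v w) = v \<bullet> v"
  proof -
    have "v \<bullet> (A *v w) = v \<bullet> (v + q w *\<^sub>R w)" by (simp add: v_def)
    then show ?thesis by (simp add: inner_add_right vw)
  qed
  \<comment> \<open>Maximality of \<open>w\<close> compared with \<open>w + t *\<^sub>R v\<close>: a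
    linear term in \<open>t\<close> is bounded by a quadratic one, which for small positive
    \<open>t\<close> forces the linear coefficient to vanish.\<close>
  have quad: "2 * t * (v \<bullet> v) \<le> t\<^sup>2 * (q w * (v \<bullet> v) - q v)" for t :: real
  proof -
    have "w + t *\<^sub>R v \<in> W" using w \<open>v \<in> W\<close> by (simp add: W_def inner_add_right)
    from q_le[OF this] have "q (w + t *\<^sub>R v) \<le> q w * ((w + t *\<^sub>R v) \<bullet> (w + t *\<^sub>R v))"
      by (simp add: dot_square_norm)
    moreover have "q (w + t *\<^sub>R v) = q w + 2 * t * (v \<bullet> v) + t\<^sup>2 * q v"
    proof -
      have "w \<bullet> (A *v v) = v \<bullet> v"
        using inner_hermitian[OF A, of w v] vA by (simp add: inner_commute)
      then show ?thesis
        using vA by (simp add: q_def matvec.add_right matvec.scaleR_right inner_add_right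
            inner_add_left power2_eq_square algebra_simps)
    qed
    moreover have "(w + t *\<^sub>R v) \<bullet> (w + t *\<^sub>R v) = 1 + t\<^sup>2 * (v \<bullet> v)"
      using vw ww
      by (simp add: inner_add_right inner_add_left power2_eq_square inner_commute[of w v])
    ultimately have "q w + 2 * t * (v \<bullet> v) + t\<^sup>2 * q v \<le> q w * (1 + t\<^sup>2 * (v \<bullet> v))"
      by simp
    then show ?thesis by (simp add: algebra_simps)
  qed
  have "v \<bullet> v = 0"
  proof (rule ccontr)
    assume "v \<bullet> v \<noteq> 0"
    then have pos: "v \<bullet> v > 0" by simp
    define K where "K = q w * (v \<bullet> v) - q v"
    define t where "t = (v \<bullet> v) / (\<bar>K\<bar> + 1)"
    have "t > 0" using pos by (simp add: t_def)
    have "t * K \<le> t * (\<bar>K\<bar> + 1)" using \<open>t > 0\<close> by (intro mult_left_mono) auto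
    also have "\<dots> = v \<bullet> v" by (simp add: t_def)
    finally have "t * (t * K) \<le> t * (v \<bullet> v)" using \<open>t > 0\<close> by simp
    moreover have "t * (v \<bullet> v) > 0" using \<open>t > 0\<close> pos by simp
    ultimately show False
      using quad[of t] by (simp add: K_def power2_eq_square mult.assoc)
  qed
  then have "A *v w = q w *\<^sub>R w" by (simp add: v_def)
  then show ?thesis using that[of w "q w"] w by (auto simp: W_def)
qed

text \<open>Induction over index sets, so that in the end the eigenvectors are indexed by
  \<open>'n\<close> itself and can serve as the columns of a matrix.\<close>

lemma hermitian_orthonormal_eigenvectors:
  fixes A :: "complex^'n^'n" and I :: "'n set"
  assumes A: "hermitian A"
  shows "\<exists>f \<mu>. (\<forall>i\<in>I. A *v f i = (\<mu> i :: real) *\<^sub>R f i) \<and>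
           (\<forall>i\<in>I. \<forall>j\<in>I. (\<Sum>k\<in>UNIV. cnj (f i $ k) * f j $ k) = (if i = j then 1 else 0))"
proof -
  have "finite I" by simp
  then show ?thesis
  proof (induction I rule: finite_induct)
    case empty
    then show ?case by simp
  next
    case (insert j I)
    then obtain f :: "'n \<Rightarrow> complex^'n" and \<mu> :: "'n \<Rightarrow> real" where
      ev: "\<And>i. i \<in> I \<Longrightarrow> A *v f i = \<mu> i *\<^sub>R f i" and
      orth: "\<And>i l. i \<in> I \<Longrightarrow> l \<in> I \<Longrightarrow>
        (\<Sum>k\<in>UNIV. cnj (f i $ k) * f l $ k) = (if i = l then 1 else 0)"
      by metis
    \<comment> \<open>Multiples by \<open>\<i>\<close> are included to obtain Hermitian
      orthogonality. The real dimension of the span is then at most twice the size of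
      \<open>I\<close>, still below \<open>DIM(complex^'n)\<close>, which is twice
      \<open>CARD('n)\<close>.\<close>
    define B where "B = f ` I \<union> (\<lambda>i. \<i> *s f i) ` I"
    have "I \<noteq> UNIV" using insert by auto
    then have "card I < CARD('n)" by (intro psubset_card_mono) auto
    moreover have "finite B" by (simp add: B_def)
    then have "dim B \<le> card B" by (rule dim_le_card')
    moreover have "card B \<le> card I + card I"
      using card_Un_le[of "f ` I" "(\<lambda>i. \<i> *s f i) ` I"]
        card_image_le[OF \<open>finite I\<close>, of f] card_image_le[OF \<open>finite I\<close>, of "\<lambda>i. \<i> *s f i"]
      unfolding B_def by linarith
    ultimately have dimB: "dim B < DIM(complex^'n)" by simp
    have inv: "\<exists>\<mu>. A *v b = \<mu> *\<^sub>R b" if "b \<in> B" for b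
    proof -
      have "A *v (\<i> *s f i) = \<mu> i *\<^sub>R (\<i> *s f i)" if "i \<in> I" for i
        using ev[OF that] by (simp add: vector_scalar_commute vec_eq_iff)
      with ev that show ?thesis unfolding B_def by auto
    qed
    obtain w \<nu> where w: "norm w = 1" "A *v w = \<nu> *\<^sub>R w" "\<And>b. b \<in> B \<Longrightarrow> b \<bullet> w = 0"
      using hermitian_eigenvector_exists[OF A dimB inv] by blast
    have fw: "(\<Sum>k\<in>UNIV. cnj (f i $ k) * w $ k) = 0" if "i \<in> I" for i
      using w(3)[of "f i"] w(3)[of "\<i> *s f i"] that
      by (auto simp: B_def inner_complex_vec inner_imult_complex_vec complex_eq_iff)
    have wf: "(\<Sum>k\<in>UNIV. cnj (w $ k) * f i $ k) = 0" if "i \<in> I" for i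
      using arg_cong[OF fw[OF that], of cnj] by (simp add: mult.commute)
    have "(\<Sum>k\<in>UNIV. cnj (w $ k) * w $ k) = complex_of_real (w \<bullet> w)"
      by (simp add: complex_eq_iff inner_vec_def inner_complex_def)
    then have ww: "(\<Sum>k\<in>UNIV. cnj (w $ k) * w $ k) = 1"
      using w(1) by (simp add: dot_square_norm)
    show ?case
    proof (intro exI[of _ "f(j := w)"] exI[of _ "\<mu>(j := \<nu>)"] conjI ballI)
      fix i assume "i \<in> insert j I"
      then show "A *v (f(j := w)) i = (\<mu>(j := \<nu>)) i *\<^sub>R (f(j := w)) i"
        using w(2) ev by auto
    next
      fix i l assume "i \<in> insert j I" "l \<in> insert j I"
      then show "(\<Sum>k\<in>UNIV. cnj ((f(j := w)) i $ k) * (f(j := w)) l $ k) = (if i = l then 1 else 0)"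
        using \<open>j \<notin> I\<close> by (cases "i = j"; cases "l = j") (simp_all add: fw wf ww orth)
    qed
  qed
qed

lemma diagm_mult_right: "(A ** diagm d) $ i $ j = A $ i $ j * d j"
  by (simp add: matrix_matrix_mult_def diagm_def if_distrib cong: if_cong)

lemma diagm_mult_left: "(diagm d ** A) $ i $ j = d i * A $ i $ j"
  by (simp add: matrix_matrix_mult_def diagm_def if_distrib if_distribR cong: if_cong)

abbreviation rdiag :: "('n \<Rightarrow> real) \<Rightarrow> complex^'n^'n" where
  "rdiag d \<equiv> diagm (\<lambda>i. complex_of_real (d i))"

lemma unitary_conj_cancel:
  assumes "unitary U"
  shows "(U ** A ** adj U) ** (U ** B ** adj U) = U ** (A ** B) ** adj U"
proof -
  have "(U ** A ** adj U) ** (U ** B ** adj U) = U ** A ** (adj U ** U) ** B ** adj U"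
    by (simp only: matrix_mul_assoc)
  also have "\<dots> = U ** A ** B ** adj U" using assms by (simp add: unitary_def)
  finally show ?thesis by (simp only: matrix_mul_assoc)
qed

theorem hermitian_diagonalization:
  fixes A :: "complex^'n^'n"
  assumes A: "hermitian A"
  obtains U d where "unitary U" "A = U ** rdiag d ** adj U"
proof -
  obtain f :: "'n \<Rightarrow> complex^'n" and \<mu> :: "'n \<Rightarrow> real" where
    ev: "\<And>i. A *v f i = \<mu> i *\<^sub>R f i" and
    orth: "\<And>i l. (\<Sum>k\<in>UNIV. cnj (f i $ k) * f l $ k) = (if i = l then 1 else 0)"
    using hermitian_orthonormal_eigenvectors[OF A, of UNIV] by auto
  define U where "U = (\<chi> i j. f j $ i)"
  have UU: "adj U ** U = mat 1"
    by (simp add: U_def adj_def matrix_matrix_mult_def mat_def vec_eq_iff orth)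
  then have "U ** adj U = mat 1"
    by (simp add: matrix_left_right_inverse)
  with UU have "unitary U" by (simp add: unitary_def)
  have "A ** U = U ** rdiag \<mu>"
  proof -
    have "(A ** U) $ i $ j = (A *v f j) $ i" for i j
      by (simp add: U_def matrix_matrix_mult_def matrix_vector_mult_def)
    then show ?thesis
      by (simp add: vec_eq_iff diagm_mult_right ev U_def scaleR_conv_of_real[where 'a=complex] mult.commute)
  qed
  then have "A = U ** rdiag \<mu> ** adj U"
    by (metis \<open>U ** adj U = mat 1\<close> matrix_mul_assoc matrix_mul_rid)
  with \<open>unitary U\<close> show ?thesis using that by blast
qed

lemma adj_rdiag [simp]: "adj (rdiag d) = rdiag d"
  by (auto simp: adj_def diagm_def vec_eq_iff)

lemma hermitian_rdiag_conj: "hermitian (U ** rdiag d ** adj U)"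
  by (simp add: hermitian_def adj_mult matrix_mul_assoc)

lemma is_eigenvalue_rdiag_conj:
  assumes U: "unitary U"
  shows "is_eigenvalue (U ** rdiag d ** adj U) (complex_of_real (d i))"
  unfolding is_eigenvalue_def
proof (intro exI conjI)
  have "norm (U *v axis i 1) = 1" using norm_unitary[OF U] by simp
  then show "U *v axis i 1 \<noteq> 0" by auto
  have "(U ** rdiag d ** adj U) *v (U *v axis i 1) = U *v (rdiag d *v axis i 1)"
  proof -
    have "(U ** rdiag d ** adj U) *v (U *v axis i 1) = (U ** rdiag d ** (adj U ** U)) *v axis i 1"
      by (simp only: matrix_vector_mul_assoc matrix_mul_assoc)
    then show ?thesis using U by (simp add: unitary_def matrix_vector_mul_assoc)
  qed
  also have "rdiag d *v axis i 1 = complex_of_real (d i) *s axis i 1"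
    by (simp add: vec_eq_iff matrix_vector_axis) (simp add: diagm_def axis_def)
  finally show "(U ** rdiag d ** adj U) *v (U *v axis i 1) = complex_of_real (d i) *s (U *v axis i 1)"
    by (simp add: vector_scalar_commute)
qed

section \<open>Positive definite matrices and well-definedness of the logarithm\<close>

lemma posdef_diagonalization:
  assumes "c \<in> posdef_set"
  obtains U d where "unitary U" "c = U ** rdiag d ** adj U" "\<And>i. d i > 0"
proof -
  obtain U d where U: "unitary U" "c = U ** rdiag d ** adj U"
    using assms hermitian_diagonalization unfolding posdef_set_def by blast
  have "d i > 0" for i
    using assms is_eigenvalue_rdiag_conj[OF U(1), of d i] U(2) by (auto simp: posdef_set_def)
  with U that show ?thesis by blast
qed

text \<open>The value in \<open>mlog\<close> is independent of the diagonalization: for two of them,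
  \<open>W = adj V ** U\<close> intertwines the diagonal matrices, so an entry of \<open>W\<close>
  can be nonzero only where the two eigenvalues agree. Then \<open>W\<close> intertwines their
  logarithms as well.\<close>

lemma mlog_rdiag_conj:
  assumes U: "unitary U"
  shows "mlog (U ** rdiag d ** adj U) = U ** rdiag (\<lambda>i. ln (d i)) ** adj U"
  unfolding mlog_def
proof (rule the_equality)
  fix B
  assume "\<exists>V e. unitary V \<and> U ** rdiag d ** adj U = V ** rdiag e ** adj V \<and>
    B = V ** rdiag (\<lambda>i. ln (e i)) ** adj V"
  then obtain V e where V: "unitary V" and eq: "U ** rdiag d ** adj U = V ** rdiag e ** adj V"
    and B: "B = V ** rdiag (\<lambda>i. ln (e i)) ** adj V" by blast
  define W where "W = adj V ** U"
  have "W ** rdiag d = adj V ** U ** rdiag d ** (adj U ** U)"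
    using U by (simp add: unitary_def W_def)
  also have "\<dots> = adj V ** (U ** rdiag d ** adj U) ** U"
    by (simp only: matrix_mul_assoc)
  also have "\<dots> = (adj V ** V) ** rdiag e ** (adj V ** U)"
    by (simp only: eq matrix_mul_assoc)
  also have "\<dots> = rdiag e ** W"
    using V by (simp add: unitary_def W_def)
  finally have Wd: "W ** rdiag d = rdiag e ** W" .
  have "W $ i $ j * d j = e i * W $ i $ j" for i j
    using arg_cong[OF Wd, of "\<lambda>M. M $ i $ j"] by (simp add: diagm_mult_left diagm_mult_right)
  then have *: "W $ i $ j = 0 \<or> d j = e i" for i j
    by (simp add: mult.commute)
  have "W $ i $ j * ln (d j) = ln (e i) * W $ i $ j" for i j
    using *[of i j] by auto
  then have comm: "W ** rdiag (\<lambda>i. ln (d i)) = rdiag (\<lambda>i. ln (e i)) ** W"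
    by (simp add: vec_eq_iff diagm_mult_left diagm_mult_right)
  have "U ** rdiag (\<lambda>i. ln (d i)) ** adj U = (V ** adj V) ** U ** rdiag (\<lambda>i. ln (d i)) ** adj U"
    using V by (simp add: unitary_def)
  also have "\<dots> = V ** (W ** rdiag (\<lambda>i. ln (d i))) ** adj U"
    by (simp only: W_def matrix_mul_assoc)
  also have "\<dots> = V ** rdiag (\<lambda>i. ln (e i)) ** (adj V ** (U ** adj U))"
    by (simp only: comm) (simp only: W_def matrix_mul_assoc)
  also have "\<dots> = B" using U by (simp add: unitary_def B)
  finally show "B = U ** rdiag (\<lambda>i. ln (d i)) ** adj U" by simp
qed (use U in blast)

section \<open>Operator norm bounds and the logarithm series\<close>

text \<open>A bound on the spectral norm, as a predicate to avoid a supremum. The norm of the type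
  is the Euclidean norm of the entries, which can exceed 1 even when all eigenvalues lie in [0,1);
  only the spectral norm yields geometric convergence of the logarithm series.\<close>

definition opnorm_le :: "complex^'n^'n \<Rightarrow> real \<Rightarrow> bool" where
  "opnorm_le A s \<longleftrightarrow> (\<forall>w. norm (A *v w) \<le> s * norm w)"

lemma opnorm_le_mono: "opnorm_le A s \<Longrightarrow> s \<le> t \<Longrightarrow> opnorm_le A t"
  unfolding opnorm_le_def by (meson mult_right_mono norm_ge_zero order_trans)

lemma opnorm_le_one: "opnorm_le (mat 1) 1"
  by (simp add: opnorm_le_def)

lemma opnorm_le_add: "opnorm_le A s \<Longrightarrow> opnorm_le B t \<Longrightarrow> opnorm_le (A + B) (s + t)"
  unfolding opnorm_le_def matvec.add_left distrib_right
  by (meson add_mono norm_triangle_le)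

lemma opnorm_le_mult:
  assumes "opnorm_le A s" "opnorm_le B t" "0 \<le> s"
  shows "opnorm_le (A ** B) (s * t)"
  unfolding opnorm_le_def
proof
  fix w
  have "norm (A *v (B *v w)) \<le> s * norm (B *v w)" using assms by (simp add: opnorm_le_def)
  also have "\<dots> \<le> s * (t * norm w)" using assms by (intro mult_left_mono) (auto simp: opnorm_le_def)
  finally show "norm ((A ** B) *v w) \<le> s * t * norm w"
    by (simp add: matrix_vector_mul_assoc mult.assoc)
qed

text \<open>One half of the equivalence of the two norms; \<open>norm_le_opnorm\<close> is the
  other. It turns norm balls, natural for Picard iteration, into regions where the spectral norm is
  controlled.\<close>

lemma opnorm_le_norm:
  obtains K where "K > 0" "\<And>A :: complex^'n^'n. opnorm_le A (K * norm A)"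
proof -
  obtain K where K: "K > 0"
    "\<And>(A :: complex^'n^'n) w. norm (A *v w) \<le> norm A * norm w * K"
    using matvec.pos_bounded by blast
  show ?thesis
    by (rule that[of K]) (use K in \<open>auto simp: opnorm_le_def mult_ac\<close>)
qed

lemma norm_le_entries:
  fixes A :: "complex^'n^'n"
  assumes ent: "\<And>i j. norm (A $ i $ j) \<le> s"
  shows "norm A \<le> (real CARD('n))\<^sup>2 * s"
proof -
  have row: "norm (A $ i) \<le> real CARD('n) * s" for i
  proof -
    have "norm (A $ i) \<le> (\<Sum>j\<in>UNIV. norm (A $ i $ j))"
      unfolding norm_vec_def[of "A $ i"] by (rule L2_set_le_sum) simp
    also have "\<dots> \<le> (\<Sum>j\<in>(UNIV :: 'n set). s)" by (intro sum_mono ent)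
    finally show ?thesis by simp
  qed
  have "norm A \<le> (\<Sum>i\<in>UNIV. norm (A $ i))"
    unfolding norm_vec_def[of A] by (rule L2_set_le_sum) simp
  also have "\<dots> \<le> (\<Sum>i\<in>(UNIV :: 'n set). real CARD('n) * s)" by (intro sum_mono row)
  finally show ?thesis by (simp add: power2_eq_square)
qed

lemma norm_le_opnorm:
  fixes A :: "complex^'n^'n"
  assumes "opnorm_le A s"
  shows "norm A \<le> (real CARD('n))\<^sup>2 * s"
proof (rule norm_le_entries)
  fix i j
  have "norm (A $ i $ j) = norm ((A *v axis j 1) $ i)"
    by (simp only: matrix_vector_axis)
  also have "\<dots> \<le> norm (A *v axis j 1)" by (rule Finite_Cartesian_Product.norm_nth_le)
  also have "\<dots> \<le> s"
    using spec[OF assms[unfolded opnorm_le_def], of "axis j 1"] by simp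
  finally show "norm (A $ i $ j) \<le> s" .
qed

lemma mpow_commute: "mpow A k ** A = A ** mpow A k"
  by (induction k) (simp_all add: matrix_mul_assoc[symmetric])

lemma adj_mpow: "adj (mpow A k) = mpow (adj A) k"
  by (induction k) (simp_all add: adj_mult mpow_commute)

lemma opnorm_le_mpow: "opnorm_le A s \<Longrightarrow> 0 \<le> s \<Longrightarrow> opnorm_le (mpow A k) (s ^ k)"
  by (induction k) (auto intro: opnorm_le_one opnorm_le_mult)

text \<open>Noncommutative telescoping: one factor is exchanged at a time. The factor
  \<open>Suc k\<close> is later cancelled by the coefficient of the logarithm series.\<close>

lemma opnorm_le_mpow_diff:
  assumes X: "opnorm_le X s" and Y: "opnorm_le Y s" and XY: "opnorm_le (X - Y) d"
    and "0 \<le> s" "0 \<le> d"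
  shows "opnorm_le (mpow X (Suc k) - mpow Y (Suc k)) (real (Suc k) * s ^ k * d)"
proof (induction k)
  case 0
  then show ?case using XY by simp
next
  case (Suc k)
  have "opnorm_le ((X - Y) ** mpow X (Suc k) + Y ** (mpow X (Suc k) - mpow Y (Suc k)))
          (d * s ^ Suc k + s * (real (Suc k) * s ^ k * d))"
    by (intro opnorm_le_add opnorm_le_mult opnorm_le_mpow assms Suc.IH)
  moreover have "(X - Y) ** mpow X (Suc k) + Y ** (mpow X (Suc k) - mpow Y (Suc k))
      = mpow X (Suc (Suc k)) - mpow Y (Suc (Suc k))"
    by (simp only: matmul.diff_left matmul.diff_right mpow.simps(2)[of _ "Suc k"]) simp
  moreover have "d * s ^ Suc k + s * (real (Suc k) * s ^ k * d) = real (Suc (Suc k)) * s ^ Suc k * d"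
    by (simp add: algebra_simps)
  ultimately show ?case by simp
qed

lemma rdiag_mult: "rdiag a ** rdiag b = rdiag (\<lambda>i. a i * b i)"
  by (auto simp: vec_eq_iff diagm_mult_right) (auto simp: diagm_def)

lemma diagm_one: "diagm (\<lambda>i. 1) = mat 1"
  by (simp add: diagm_def mat_def)

lemma mpow_rdiag_conj:
  assumes "unitary U"
  shows "mpow (U ** rdiag d ** adj U) k = U ** rdiag (\<lambda>i. d i ^ k) ** adj U"
proof (induction k)
  case 0
  then show ?case using assms by (simp add: unitary_def diagm_one)
next
  case (Suc k)
  show ?case
    by (simp only: mpow.simps Suc.IH unitary_conj_cancel[OF assms] rdiag_mult power_Suc)
qed

lemma opnorm_le_rdiag_conj:
  assumes U: "unitary U" and d: "\<And>i. \<bar>d i\<bar> \<le> s"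
  shows "opnorm_le (U ** rdiag d ** adj U) s"
  unfolding opnorm_le_def
proof
  fix w
  let ?v = "adj U *v w"
  have "norm ((U ** rdiag d ** adj U) *v w) = norm (rdiag d *v ?v)"
    using norm_unitary[OF U, of "rdiag d *v ?v"] by (simp add: matrix_vector_mul_assoc matrix_mul_assoc)
  also have "\<dots> \<le> norm (s *\<^sub>R ?v)"
  proof (rule norm_le_componentwise_cart)
    fix i
    have "(rdiag d *v ?v) $ i = complex_of_real (d i) * ?v $ i"
      unfolding matrix_vector_mult_def[of "rdiag d"]
      by (simp add: diagm_def if_distribR if_distrib[of "\<lambda>x. x * _"] cong: if_cong)
    then show "norm ((rdiag d *v ?v) $ i) \<le> norm ((s *\<^sub>R ?v) $ i)"
      using d[of i] by (simp add: norm_mult mult_right_mono)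
  qed
  also have "\<dots> = s * norm w"
    using norm_unitary[OF unitary_adj[OF U]] order_trans[OF abs_ge_zero d] by simp
  finally show "norm ((U ** rdiag d ** adj U) *v w) \<le> s * norm w" .
qed

section \<open>The logarithm as a power series\<close>

text \<open>The series of -log (I - X), without constant term, defined with no reference to
  eigenvalues.\<close>

definition logser :: "complex^'n^'n \<Rightarrow> complex^'n^'n" where
  "logser X = (\<Sum>k. (1 / real (Suc k)) *\<^sub>R mpow X (Suc k))"

lemma logser_term_bound:
  fixes X :: "complex^'n^'n"
  assumes "opnorm_le X s" "0 \<le> s" "s < 1"
  shows "norm ((1 / real (Suc k)) *\<^sub>R mpow X (Suc k)) \<le> (real CARD('n))\<^sup>2 * s ^ k"
proof -
  have "norm ((1 / real (Suc k)) *\<^sub>R mpow X (Suc k)) \<le> norm (mpow X (Suc k))"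
    by (simp add: field_simps)
  also have "\<dots> \<le> (real CARD('n))\<^sup>2 * s ^ Suc k"
    by (intro norm_le_opnorm opnorm_le_mpow assms)
  also have "\<dots> \<le> (real CARD('n))\<^sup>2 * s ^ k"
    using assms by (intro mult_left_mono power_decreasing) auto
  finally show ?thesis .
qed

lemma summable_logser:
  assumes "opnorm_le X s" "0 \<le> s" "s < 1"
  shows "summable (\<lambda>k. (1 / real (Suc k)) *\<^sub>R mpow X (Suc k))"
  by (rule summable_comparison_test'[OF _ logser_term_bound[OF assms]])
    (use assms in \<open>auto intro!: summable_mult summable_geometric\<close>)

text \<open>Differences of terms are dominated by a geometric series in \<open>s\<close>, as for the
  derivative 1 / (1 - s) of -ln (1 - s). The constant blows up as \<open>s\<close> tends to 1,
  whence the need for a fixed bound below 1.\<close>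

lemma logser_lipschitz:
  assumes "0 \<le> s" "s < 1"
  obtains C where "C \<ge> 0"
    "\<And>X Y :: complex^'n^'n. opnorm_le X s \<Longrightarrow> opnorm_le Y s \<Longrightarrow>
       norm (logser X - logser Y) \<le> C * norm (X - Y)"
proof -
  obtain K where K: "K > 0" "\<And>A :: complex^'n^'n. opnorm_le A (K * norm A)"
    using opnorm_le_norm by blast
  define C where "C = (real CARD('n))\<^sup>2 * K / (1 - s)"
  have "norm (logser X - logser Y) \<le> C * norm (X - Y)"
    if X: "opnorm_le X s" and Y: "opnorm_le Y s" for X Y :: "complex^'n^'n"
  proof -
    define D where "D = (real CARD('n))\<^sup>2 * K * norm (X - Y)"
    have "logser X - logser Y = (\<Sum>k. (1 / real (Suc k)) *\<^sub>R (mpow X (Suc k) - mpow Y (Suc k)))"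
      unfolding logser_def scaleR_diff_right
      by (rule suminf_diff[OF summable_logser[OF X assms] summable_logser[OF Y assms]])
    also have "norm \<dots> \<le> (\<Sum>k. D * s ^ k)"
    proof (rule norm_suminf_le)
      fix k
      have "norm (mpow X (Suc k) - mpow Y (Suc k))
          \<le> (real CARD('n))\<^sup>2 * (real (Suc k) * s ^ k * (K * norm (X - Y)))"
        using K by (intro norm_le_opnorm opnorm_le_mpow_diff X Y assms) auto
      then have "norm (mpow X (Suc k) - mpow Y (Suc k)) \<le> D * s ^ k * real (Suc k)"
        by (simp only: D_def mult_ac)
      then have "norm (mpow X (Suc k) - mpow Y (Suc k)) / real (Suc k) \<le> D * s ^ k"
        by (subst pos_divide_le_eq) auto
      then show "norm ((1 / real (Suc k)) *\<^sub>R (mpow X (Suc k) - mpow Y (Suc k))) \<le> D * s ^ k"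
        by (simp only: norm_scaleR) simp
    qed (use assms in \<open>auto intro!: summable_mult summable_geometric\<close>)
    also have "\<dots> = C * norm (X - Y)"
      using assms by (simp add: suminf_mult suminf_geometric summable_geometric C_def D_def)
    finally show ?thesis .
  qed
  moreover have "C \<ge> 0" using K assms by (simp add: C_def)
  ultimately show ?thesis using that by blast
qed

lemma adj_logser:
  assumes "opnorm_le X s" "0 \<le> s" "s < 1"
  shows "adj (logser X) = logser (adj X)"
  unfolding logser_def bounded_linear.suminf[OF bounded_linear_adj summable_logser[OF assms]]
  by (simp only: adj_scaleR adj_mpow)

lemma minus_ln_sums:
  fixes x :: real
  assumes "\<bar>x\<bar> < 1"
  shows "(\<lambda>k. 1 / real (Suc k) * x ^ Suc k) sums (- ln (1 - x))"
proof -
  have "(\<lambda>n. x ^ n / real n) sums (- ln (1 - x))"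
    using sums_minus[OF ln_series'[of "- x"]] assms by simp
  \<comment> \<open>Dropping the term of index 0 leaves the sum unchanged, because division by zero
    gives 0.\<close>
  then have "(\<lambda>k. x ^ Suc k / real (Suc k)) sums (- ln (1 - x))"
    by (subst sums_Suc_iff) simp
  then show ?thesis by simp
qed

lemma tendsto_rdiag:
  assumes "\<And>i. ((\<lambda>x. d x i) \<longlongrightarrow> e i) F"
  shows "((\<lambda>x. rdiag (d x)) \<longlongrightarrow> rdiag e) F"
  unfolding diagm_def by (intro tendsto_vec_lambda) (auto intro!: tendsto_of_real assms)

lemma logser_rdiag_conj:
  assumes U: "unitary U" and d: "\<And>i. \<bar>d i\<bar> < 1"
  shows "logser (U ** rdiag d ** adj U) = U ** rdiag (\<lambda>i. - ln (1 - d i)) ** adj U"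
proof -
  have "(\<lambda>k. (1 / real (Suc k)) *\<^sub>R mpow (U ** rdiag d ** adj U) (Suc k)) sums
      (U ** rdiag (\<lambda>i. - ln (1 - d i)) ** adj U)"
    unfolding sums_def
  proof (rule Lim_transform_eventually)
    show "(\<lambda>n. U ** rdiag (\<lambda>i. \<Sum>k<n. 1 / real (Suc k) * d i ^ Suc k) ** adj U)
        \<longlonglongrightarrow> U ** rdiag (\<lambda>i. - ln (1 - d i)) ** adj U"
      by (intro matmul.tendsto tendsto_rdiag tendsto_const)
        (use minus_ln_sums[OF d] in \<open>simp add: sums_def\<close>)
    have "U ** rdiag (\<lambda>i. \<Sum>k<n. 1 / real (Suc k) * d i ^ Suc k) ** adj U
        = (\<Sum>k<n. (1 / real (Suc k)) *\<^sub>R mpow (U ** rdiag d ** adj U) (Suc k))" for n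
    proof -
      have "rdiag (\<lambda>i. \<Sum>k<n. 1 / real (Suc k) * d i ^ Suc k)
          = (\<Sum>k<n. (1 / real (Suc k)) *\<^sub>R rdiag (\<lambda>i. d i ^ Suc k))"
        by (auto simp: diagm_def vec_eq_iff scaleR_conv_of_real[where 'a=complex] simp del: of_nat_Suc)
      then show ?thesis
        by (simp only: mpow_rdiag_conj[OF U] matmul.sum_left matmul.sum_right
            matmul.scaleR_left matmul.scaleR_right)
    qed
    then show "\<forall>\<^sub>F n in sequentially. U ** rdiag (\<lambda>i. \<Sum>k<n. 1 / real (Suc k) * d i ^ Suc k) ** adj U
        = (\<Sum>k<n. (1 / real (Suc k)) *\<^sub>R mpow (U ** rdiag d ** adj U) (Suc k))"
      by simp
  qed
  then show ?thesis by (simp add: logser_def sums_iff)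
qed

text \<open>The bridge from \<open>mlog\<close>, a choice through diagonalization, to the analytic
  function \<open>logser\<close>. The term with \<open>ln T\<close> is scalar and disappears under
  \<open>lap\<close>.\<close>

lemma mlog_eq_logser:
  assumes U: "unitary U" and d: "\<And>i. \<bar>d i\<bar> < 1" and "T > 0"
    and X: "X = U ** rdiag d ** adj U"
  shows "mlog (T *\<^sub>R (mat 1 - X)) = ln T *\<^sub>R mat 1 - logser X"
proof -
  have one: "mat 1 = U ** rdiag (\<lambda>i. 1) ** adj U"
    using U by (simp add: diagm_one unitary_def)
  have "T *\<^sub>R (mat 1 - X) = U ** (T *\<^sub>R (rdiag (\<lambda>i. 1) - rdiag d)) ** adj U"
    unfolding X by (subst one)
      (simp only: matmul.scaleR_left matmul.scaleR_right matmul.diff_left matmul.diff_right)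
  also have "T *\<^sub>R (rdiag (\<lambda>i. 1) - rdiag d) = rdiag (\<lambda>i. T * (1 - d i))"
    by (auto simp: diagm_def vec_eq_iff scaleR_conv_of_real[where 'a=complex])
  finally have "mlog (T *\<^sub>R (mat 1 - X)) = U ** rdiag (\<lambda>i. ln (T * (1 - d i))) ** adj U"
    by (simp only: mlog_rdiag_conj[OF U])
  also have "rdiag (\<lambda>i. ln (T * (1 - d i))) = ln T *\<^sub>R rdiag (\<lambda>i. 1) - rdiag (\<lambda>i. - ln (1 - d i))"
  proof -
    have "ln (T * (1 - d i)) = ln T + ln (1 - d i)" for i
      using d[of i] \<open>T > 0\<close> by (simp add: ln_mult)
    then show ?thesis
      by (auto simp: diagm_def vec_eq_iff scaleR_conv_of_real[where 'a=complex])
  qed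
  also have "U ** \<dots> ** adj U = ln T *\<^sub>R mat 1 - logser X"
    unfolding X logser_rdiag_conj[OF U d]
    by (subst one) (simp only: matmul.scaleR_left matmul.scaleR_right matmul.diff_left matmul.diff_right)
  finally show ?thesis .
qed

section \<open>The Laplacian and the equation in the coordinate X\<close>

lemma commut_minus: "commut a (- b) = - commut a b"
  by (simp add: commut_def matmul.minus_left matmul.minus_right)

lemma lap_eq: "lap x y a = commut y (commut y a) + commut x (commut x a)"
  by (simp add: lap_def delta1_def delta2_def commut_minus)

lemma bounded_linear_commut: "bounded_linear (commut a)"
  unfolding commut_def
  by (intro bounded_linear_sub matmul.bounded_linear_left matmul.bounded_linear_right)

lemma bounded_linear_lap: "bounded_linear (lap x y)"
  unfolding lap_eq
  by (intro bounded_linear_add bounded_linear_compose[OF bounded_linear_commut] bounded_linear_commut)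

lemma lap_scalar: "lap x y (r *\<^sub>R mat 1) = 0"
  by (simp add: lap_eq commut_def matmul.scaleR_left matmul.scaleR_right)

lemma adj_commut: "hermitian a \<Longrightarrow> adj (commut a b) = - commut a (adj b)"
  by (simp add: commut_def adj_diff adj_mult hermitian_def)

lemma adj_lap: "hermitian x \<Longrightarrow> hermitian y \<Longrightarrow> adj (lap x y a) = lap x y (adj a)"
  by (simp add: lap_eq adj_add adj_commut commut_minus)

definition ricci_field ::
  "complex^'n^'n \<Rightarrow> complex^'n^'n \<Rightarrow> real \<Rightarrow> complex^'n^'n \<Rightarrow> complex^'n^'n" where
  "ricci_field x y T X = (- 1 / T) *\<^sub>R lap x y (logser X)"

lemma ricci_field_lipschitz:
  fixes x y :: "complex^'n^'n"
  assumes "0 \<le> s" "s < 1"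
  obtains L where "L \<ge> 0"
    "\<And>X Y. opnorm_le X s \<Longrightarrow> opnorm_le Y s \<Longrightarrow>
       norm (ricci_field x y T X - ricci_field x y T Y) \<le> L * norm (X - Y)"
proof -
  obtain C where C: "C \<ge> 0" "\<And>X Y :: complex^'n^'n. opnorm_le X s \<Longrightarrow> opnorm_le Y s \<Longrightarrow>
       norm (logser X - logser Y) \<le> C * norm (X - Y)"
    using logser_lipschitz[OF assms] by blast
  obtain M where M: "M \<ge> 0" "\<And>a. norm (lap x y a) \<le> norm a * M"
    using bounded_linear.nonneg_bounded[OF bounded_linear_lap] by blast
  have "norm (ricci_field x y T X - ricci_field x y T Y) \<le> (\<bar>1 / T\<bar> * (C * M)) * norm (X - Y)"
    if "opnorm_le X s" "opnorm_le Y s" for X Y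
  proof -
    have "norm (ricci_field x y T X - ricci_field x y T Y)
        = \<bar>1 / T\<bar> * norm (lap x y (logser X - logser Y))"
      by (simp only: ricci_field_def linear_diff[OF bounded_linear.linear[OF bounded_linear_lap]]
          scaleR_diff_right[symmetric] norm_scaleR) simp
    also have "\<dots> \<le> \<bar>1 / T\<bar> * (norm (logser X - logser Y) * M)"
      by (intro mult_left_mono M) auto
    also have "\<dots> \<le> \<bar>1 / T\<bar> * ((C * norm (X - Y)) * M)"
      by (intro mult_left_mono mult_right_mono C M that) auto
    finally show ?thesis by (simp add: mult_ac)
  qed
  then show ?thesis using C M that[of "\<bar>1 / T\<bar> * (C * M)"] by simp
qed

text \<open>The field commutes with the adjoint, so the adjoint of a solution in real time is again
  a solution; combined with uniqueness this preserves Hermitian initial data.\<close>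

lemma adj_ricci_field:
  assumes "hermitian x" "hermitian y" "opnorm_le X s" "0 \<le> s" "s < 1"
  shows "adj (ricci_field x y T X) = ricci_field x y T (adj X)"
  by (simp only: ricci_field_def adj_scaleR adj_lap[OF assms(1,2)] adj_logser[OF assms(3-5)])

section \<open>Matrix-valued holomorphic functions\<close>

definition mat_holomorphic :: "(complex \<Rightarrow> complex^'n^'n) \<Rightarrow> complex set \<Rightarrow> bool" where
  "mat_holomorphic X S \<longleftrightarrow> (\<forall>i j. (\<lambda>z. X z $ i $ j) holomorphic_on S)"

lemma mat_holomorphic_mult:
  "mat_holomorphic X S \<Longrightarrow> mat_holomorphic Y S \<Longrightarrow> mat_holomorphic (\<lambda>z. X z ** Y z) S"
  by (auto simp: mat_holomorphic_def matrix_matrix_mult_def intro!: holomorphic_intros)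

lemma mat_holomorphic_const: "mat_holomorphic (\<lambda>z. A) S"
  by (simp add: mat_holomorphic_def)

lemma mat_holomorphic_add:
  "mat_holomorphic X S \<Longrightarrow> mat_holomorphic Y S \<Longrightarrow> mat_holomorphic (\<lambda>z. X z + Y z) S"
  by (auto simp: mat_holomorphic_def intro!: holomorphic_intros)

lemma mat_holomorphic_diff:
  "mat_holomorphic X S \<Longrightarrow> mat_holomorphic Y S \<Longrightarrow> mat_holomorphic (\<lambda>z. X z - Y z) S"
  by (auto simp: mat_holomorphic_def intro!: holomorphic_intros)

lemma mat_holomorphic_scaleR:
  "mat_holomorphic X S \<Longrightarrow> mat_holomorphic (\<lambda>z. r *\<^sub>R X z) S"
  by (auto simp: mat_holomorphic_def scaleR_conv_of_real[where 'a=complex] intro!: holomorphic_intros)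

lemma mat_holomorphic_mpow:
  "mat_holomorphic X S \<Longrightarrow> mat_holomorphic (\<lambda>z. mpow (X z) k) S"
  by (induction k) (auto intro: mat_holomorphic_const mat_holomorphic_mult)

text \<open>The partial sums are polynomials in \<open>X z\<close> and converge uniformly by the
  bound \<open>logser_term_bound\<close>, which does not depend on \<open>z\<close>.\<close>

lemma mat_holomorphic_logser:
  fixes X :: "complex \<Rightarrow> complex^'n^'n"
  assumes X: "mat_holomorphic X S" and S: "open S" and bd: "\<And>z. z \<in> S \<Longrightarrow> opnorm_le (X z) s"
    and s: "0 \<le> s" "s < 1"
  shows "mat_holomorphic (\<lambda>z. logser (X z)) S"
  unfolding mat_holomorphic_def
proof (intro allI)
  fix i j
  let ?f = "\<lambda>k z. ((1 / real (Suc k)) *\<^sub>R mpow (X z) (Suc k)) $ i $ j"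
  have ent: "bounded_linear (\<lambda>A :: complex^'n^'n. A $ i $ j)"
    by (intro bounded_linear_compose[OF bounded_linear_vec_nth] bounded_linear_vec_nth)
  have eq: "logser (X z) $ i $ j = (\<Sum>k. ?f k z)" if "z \<in> S" for z
    unfolding logser_def
    by (rule bounded_linear.suminf[OF ent summable_logser[OF bd[OF that] s]])
  have "(\<lambda>z. \<Sum>k. ?f k z) holomorphic_on S"
  proof (rule holomorphic_uniform_sequence[OF S])
    show "(\<lambda>z. \<Sum>k<n. ?f k z) holomorphic_on S" for n
      using mat_holomorphic_scaleR[OF mat_holomorphic_mpow[OF X]]
      by (intro holomorphic_on_sum) (auto simp only: mat_holomorphic_def)
  next
    fix z assume "z \<in> S"
    then obtain d where d: "d > 0" "cball z d \<subseteq> S" using S open_contains_cball by blast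
    have "uniform_limit (cball z d) (\<lambda>n z. \<Sum>k<n. ?f k z) (\<lambda>z. \<Sum>k. ?f k z) sequentially"
    proof (rule Weierstrass_m_test)
      show "summable (\<lambda>k. (real CARD('n))\<^sup>2 * s ^ k)"
        using s by (auto intro!: summable_mult summable_geometric)
      fix k w assume "w \<in> cball z d"
      with d have "w \<in> S" by blast
      have "norm (?f k w) \<le> norm ((1 / real (Suc k)) *\<^sub>R mpow (X w) (Suc k))"
        by (meson Finite_Cartesian_Product.norm_nth_le order_trans)
      also have "\<dots> \<le> (real CARD('n))\<^sup>2 * s ^ k"
        by (rule logser_term_bound[OF bd[OF \<open>w \<in> S\<close>] s])
      finally show "norm (?f k w) \<le> (real CARD('n))\<^sup>2 * s ^ k" .
    qed
    with d show "\<exists>d>0. cball z d \<subseteq> S \<and>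
        uniform_limit (cball z d) (\<lambda>n z. \<Sum>k<n. ?f k z) (\<lambda>z. \<Sum>k. ?f k z) sequentially"
      by blast
  qed
  then show "(\<lambda>z. logser (X z) $ i $ j) holomorphic_on S"
    using eq by (simp cong: holomorphic_cong)
qed

lemma mat_holomorphic_ricci_field:
  assumes "mat_holomorphic X S" "open S" "\<And>z. z \<in> S \<Longrightarrow> opnorm_le (X z) s" "0 \<le> s" "s < 1"
  shows "mat_holomorphic (\<lambda>z. ricci_field x y T (X z)) S"
  unfolding ricci_field_def lap_eq commut_def
  by (intro mat_holomorphic_scaleR mat_holomorphic_add mat_holomorphic_diff mat_holomorphic_mult
      mat_holomorphic_const mat_holomorphic_logser[OF assms])

section \<open>Holomorphic Picard iteration\<close>

lemma matrix_primitive: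
  fixes G :: "complex \<Rightarrow> complex^'n^'n"
  assumes "mat_holomorphic G (ball 0 r)"
  shows "\<exists>P. P 0 = X0 \<and> (\<forall>z\<in>ball 0 r. \<forall>i j.
           ((\<lambda>w. P w $ i $ j) has_field_derivative G z $ i $ j) (at z))"
proof -
  have "\<exists>g. \<forall>z\<in>ball 0 r. (g has_field_derivative G z $ i $ j) (at z)" for i j
  proof -
    have "(\<lambda>z. G z $ i $ j) holomorphic_on ball 0 r"
      using assms by (simp add: mat_holomorphic_def)
    then obtain g where "\<And>z. z \<in> ball 0 r \<Longrightarrow> (g has_field_derivative G z $ i $ j) (at z within ball 0 r)"
      using holomorphic_convex_primitive'[of "ball 0 r"] by blast
    then show ?thesis by (metis at_within_open open_ball)
  qed
  then obtain g where g: "\<And>i j z. z \<in> ball 0 r \<Longrightarrow> (g i j has_field_derivative G z $ i $ j) (at z)"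
    by metis
  show ?thesis
    by (rule exI[of _ "\<lambda>z. \<chi> i j. g i j z + (X0 $ i $ j - g i j 0)"])
      (auto simp: vec_eq_iff intro!: derivative_eq_intros g)
qed

text \<open>The substitute for estimating an integral. The mean value inequality is applied to each
  entry, and returning from entries to the norm costs the factor
  \<open>(real CARD('n))\<^sup>2\<close> seen in the smallness conditions of the iteration.\<close>

lemma norm_le_of_derivative_bound:
  fixes D :: "complex \<Rightarrow> complex^'n^'n"
  assumes der: "\<And>z i j. z \<in> ball 0 r \<Longrightarrow> ((\<lambda>w. D w $ i $ j) has_field_derivative D' z $ i $ j) (at z)"
    and bd: "\<And>z. z \<in> ball 0 r \<Longrightarrow> norm (D' z) \<le> B" and "D 0 = 0" and z: "z \<in> ball 0 r"
  shows "norm (D z) \<le> (real CARD('n))\<^sup>2 * (B * r)"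
proof (rule norm_le_entries)
  fix i j
  have B: "norm (D' w $ i $ j) \<le> B" if "w \<in> ball 0 r" for w
    by (meson Finite_Cartesian_Product.norm_nth_le bd order_trans that)
  have "(0 :: complex) \<in> ball 0 r" using z order_le_less_trans[OF norm_ge_zero] by auto
  have "norm (D z $ i $ j - D 0 $ i $ j) \<le> B * norm (z - 0)"
    by (rule field_differentiable_bound[OF convex_ball has_field_derivative_at_within[OF der] B z])
      (use \<open>0 \<in> ball 0 r\<close> in auto)
  also have "\<dots> \<le> B * r"
    using z order_trans[OF norm_ge_zero bd[OF z]] by (intro mult_left_mono) auto
  finally show "norm (D z $ i $ j) \<le> B * r" using \<open>D 0 = 0\<close> by simp
qed

text \<open>Picard iteration in complex time: the iterates are entrywise holomorphic, hence so is
  their uniform limit. Primitives on the disc replace the usual integrals.\<close>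

lemma holomorphic_picard:
  fixes F :: "complex^'n^'n \<Rightarrow> complex^'n^'n"
  assumes r: "r > 0" and "\<delta> \<ge> 0" and "L \<ge> 0"
    and bd: "\<And>X. norm (X - X0) \<le> \<delta> \<Longrightarrow> norm (F X) \<le> B"
    and lip: "\<And>X Y. norm (X - X0) \<le> \<delta> \<Longrightarrow> norm (Y - X0) \<le> \<delta> \<Longrightarrow> norm (F X - F Y) \<le> L * norm (X - Y)"
    and hol: "\<And>X. mat_holomorphic X (ball 0 r) \<Longrightarrow> (\<And>z. z \<in> ball 0 r \<Longrightarrow> norm (X z - X0) \<le> \<delta>)
      \<Longrightarrow> mat_holomorphic (\<lambda>z. F (X z)) (ball 0 r)"
    and B_small: "(real CARD('n))\<^sup>2 * (B * r) \<le> \<delta>"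
    and L_small: "(real CARD('n))\<^sup>2 * (L * r) \<le> 1 / 2"
  obtains X where "X 0 = X0" "\<And>z. z \<in> ball 0 r \<Longrightarrow> norm (X z - X0) \<le> \<delta>"
    "\<And>z i j. z \<in> ball 0 r \<Longrightarrow> ((\<lambda>w. X w $ i $ j) has_field_derivative F (X z) $ i $ j) (at z)"
proof -
  let ?D = "ball (0 :: complex) r"
  obtain prim where prim: "\<And>G. mat_holomorphic G ?D \<Longrightarrow> prim G 0 = X0 \<and>
      (\<forall>z\<in>?D. \<forall>i j. ((\<lambda>w. prim G w $ i $ j) has_field_derivative G z $ i $ j) (at z))"
    using matrix_primitive[of _ r X0] by metis
  define Xs where "Xs = rec_nat (\<lambda>_. X0) (\<lambda>_ Y. prim (\<lambda>z. F (Y z)))"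
  have Xs_0: "Xs 0 = (\<lambda>_. X0)" and Xs_Suc: "Xs (Suc n) = prim (\<lambda>z. F (Xs n z))" for n
    by (simp_all add: Xs_def)
  \<comment> \<open>\<open>prim\<close> is specified only on holomorphic maps, so holomorphy and the
    distance bound must travel together: both are needed for \<open>F\<close> of an iterate to have
    a primitive.\<close>
  have inv: "mat_holomorphic (Xs n) ?D \<and> (\<forall>z\<in>?D. norm (Xs n z - X0) \<le> \<delta>) \<and> Xs n 0 = X0" for n
  proof (induction n)
    case 0
    show ?case using \<open>\<delta> \<ge> 0\<close> by (simp add: Xs_0 mat_holomorphic_const)
  next
    case (Suc n)
    then have p: "Xs (Suc n) 0 = X0"
        "\<And>z i j. z \<in> ?D \<Longrightarrow> ((\<lambda>w. Xs (Suc n) w $ i $ j) has_field_derivative F (Xs n z) $ i $ j) (at z)"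
      using prim[OF hol[of "Xs n"]] by (auto simp: Xs_Suc)
    have "mat_holomorphic (Xs (Suc n)) ?D"
      unfolding mat_holomorphic_def holomorphic_on_open[OF open_ball] using p(2) by blast
    moreover have "norm (Xs (Suc n) z - X0) \<le> \<delta>" if "z \<in> ?D" for z
    proof -
      have "norm (Xs (Suc n) z - X0) \<le> (real CARD('n))\<^sup>2 * (B * r)"
        by (rule norm_le_of_derivative_bound[where D' = "\<lambda>z. F (Xs n z)"])
          (use p Suc that in \<open>auto intro!: derivative_eq_intros bd\<close>)
      with B_small show ?thesis by simp
    qed
    ultimately show ?case using p(1) by simp
  qed
  have der: "((\<lambda>w. Xs (Suc n) w $ i $ j) has_field_derivative F (Xs n z) $ i $ j) (at z)"
    if "z \<in> ?D" for n z i j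
    using prim[OF hol[of "Xs n"]] inv[of n] that by (auto simp: Xs_Suc)
  \<comment> \<open>The ratio 1/2 comes from \<open>L_small\<close>: each increment is controlled by
    the Lipschitz constant times the preceding one, multiplied by the radius and the entry
    factor.\<close>
  have step: "norm (Xs (Suc n) z - Xs n z) \<le> \<delta> * (1 / 2) ^ n" if "z \<in> ?D" for n z
    using that
  proof (induction n arbitrary: z)
    case 0
    then show ?case using inv[of "Suc 0"] by (simp add: Xs_0)
  next
    case (Suc n)
    have "norm (Xs (Suc (Suc n)) z - Xs (Suc n) z) \<le> (real CARD('n))\<^sup>2 * ((L * (\<delta> * (1 / 2) ^ n)) * r)"
    proof (rule norm_le_of_derivative_bound[where D' = "\<lambda>z. F (Xs (Suc n) z) - F (Xs n z)"])
      fix w assume w: "w \<in> ?D"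
      have "norm (F (Xs (Suc n) w) - F (Xs n w)) \<le> L * norm (Xs (Suc n) w - Xs n w)"
        using inv w by (intro lip) auto
      also have "\<dots> \<le> L * (\<delta> * (1 / 2) ^ n)"
        using Suc.IH[OF w] \<open>L \<ge> 0\<close> by (intro mult_left_mono)
      finally show "norm (F (Xs (Suc n) w) - F (Xs n w)) \<le> L * (\<delta> * (1 / 2) ^ n)" .
      show "((\<lambda>w. (Xs (Suc (Suc n)) w - Xs (Suc n) w) $ i $ j) has_field_derivative
          (F (Xs (Suc n) w) - F (Xs n w)) $ i $ j) (at w)" for i j
        using DERIV_diff[OF der[OF w, of "Suc n" i j] der[OF w, of n i j]] by simp
    next
      show "Xs (Suc (Suc n)) 0 - Xs (Suc n) 0 = 0" using inv by simp
    qed fact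
    also have "\<dots> = ((real CARD('n))\<^sup>2 * (L * r)) * (\<delta> * (1 / 2) ^ n)" by (simp add: mult_ac)
    also have "\<dots> \<le> 1 / 2 * (\<delta> * (1 / 2) ^ n)"
      using L_small \<open>\<delta> \<ge> 0\<close> by (intro mult_right_mono) auto
    finally show ?case by simp
  qed
  define X where "X z = X0 + (\<Sum>k. Xs (Suc k) z - Xs k z)" for z
  have Xs_sum: "Xs n z = X0 + (\<Sum>k<n. Xs (Suc k) z - Xs k z)" for n z
    by (simp add: sum_lessThan_telescope[of "\<lambda>k. Xs k z"] Xs_0)
  have "uniform_limit ?D (\<lambda>n z. \<Sum>k<n. Xs (Suc k) z - Xs k z) (\<lambda>z. \<Sum>k. Xs (Suc k) z - Xs k z) sequentially"
    by (rule Weierstrass_m_test[OF step]) (auto intro!: summable_mult summable_geometric)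
  then have "uniform_limit ?D (\<lambda>n z. X0 + (\<Sum>k<n. Xs (Suc k) z - Xs k z)) X sequentially"
    unfolding X_def by (intro uniform_limit_intros)
  then have ul: "uniform_limit ?D Xs X sequentially"
    by (simp add: Xs_sum[symmetric])
  have lim: "(\<lambda>n. Xs n z) \<longlonglongrightarrow> X z" if "z \<in> ?D" for z
    using tendsto_uniform_limitI[OF ul that] .
  have X_bd: "norm (X z - X0) \<le> \<delta>" if "z \<in> ?D" for z
    by (rule Lim_bounded[OF tendsto_norm[OF tendsto_diff[OF lim[OF that] tendsto_const]]])
      (use inv that in auto)
  have "X 0 = X0"
    using lim[of 0] inv r by (auto intro: LIMSEQ_unique)
  moreover have "((\<lambda>w. X w $ i $ j) has_field_derivative F (X z) $ i $ j) (at z)" if z: "z \<in> ?D" for z i j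
  proof -
    have "uniform_limit ?D (\<lambda>n z. Xs n z $ i $ j) (\<lambda>z. X z $ i $ j) sequentially"
      by (intro bounded_linear.uniform_limit[OF bounded_linear_compose[OF bounded_linear_vec_nth bounded_linear_vec_nth]] ul)
    \<comment> \<open>The sequence is shifted by one because the derivative of iterate
      \<open>Suc n\<close> is \<open>F\<close> at iterate \<open>n\<close>. The derivatives thus
      converge to \<open>F (X z)\<close>, while the functions still converge to
      \<open>X\<close>.\<close>
    then have ulS: "uniform_limit ?D (\<lambda>n z. Xs (Suc n) z $ i $ j) (\<lambda>z. X z $ i $ j) sequentially"
      by (rule filterlim_compose[OF _ filterlim_Suc])
    have "\<exists>g'. \<forall>w\<in>?D. ((\<lambda>w. X w $ i $ j) has_field_derivative g' w) (at w) \<and>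
        (\<lambda>n. F (Xs n w) $ i $ j) \<longlonglongrightarrow> g' w"
    proof (rule has_complex_derivative_uniform_sequence[where f = "\<lambda>n w. Xs (Suc n) w $ i $ j"])
      fix w assume "w \<in> ?D"
      then obtain d where "d > 0" "cball w d \<subseteq> ?D"
        using open_contains_cball[THEN iffD1, OF open_ball] by blast
      then show "\<exists>d>0. cball w d \<subseteq> ?D \<and>
          uniform_limit (cball w d) (\<lambda>n w. Xs (Suc n) w $ i $ j) (\<lambda>w. X w $ i $ j) sequentially"
        using uniform_limit_on_subset[OF ulS] by blast
    qed (auto intro: der)
    then obtain d where d: "((\<lambda>w. X w $ i $ j) has_field_derivative d) (at z)"
        and "(\<lambda>n. F (Xs n z) $ i $ j) \<longlonglongrightarrow> d"
      using z by blast
    moreover have "(\<lambda>n. F (Xs n z)) \<longlonglongrightarrow> F (X z)"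
    proof (rule Lim_null_comparison[THEN LIM_zero_cancel])
      show "\<forall>\<^sub>F n in sequentially. norm (F (Xs n z) - F (X z)) \<le> L * norm (Xs n z - X z)"
        using lip inv X_bd z by (intro always_eventually) auto
      have "(\<lambda>n. L * norm (Xs n z - X z)) \<longlonglongrightarrow> L * norm (X z - X z)"
        by (intro tendsto_intros lim z)
      then show "(\<lambda>n. L * norm (Xs n z - X z)) \<longlonglongrightarrow> 0" by simp
    qed
    then have "(\<lambda>n. F (Xs n z) $ i $ j) \<longlonglongrightarrow> F (X z) $ i $ j"
      by (intro tendsto_vec_nth)
    ultimately show ?thesis using LIMSEQ_unique by blast
  qed
  ultimately show ?thesis using that X_bd by blast
qed

section \<open>Monotonicity and uniqueness for ordinary differential equations\<close>

lemma nonincreasing_of_derivative_within: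
  fixes f :: "real \<Rightarrow> real"
  assumes "a \<le> b" and der: "\<And>t. t \<in> {a..b} \<Longrightarrow> (f has_real_derivative f' t) (at t within {a..b})"
    and le: "\<And>t. t \<in> {a..b} \<Longrightarrow> f' t \<le> 0"
  shows "f b \<le> f a"
proof (rule DERIV_nonpos_imp_decreasing_open[OF \<open>a \<le> b\<close>])
  fix t assume "a < t" "t < b"
  then show "\<exists>y. (f has_real_derivative y) (at t) \<and> y \<le> 0"
    using der[of t] le[of t] by (auto simp: at_within_Icc_at)
next
  show "continuous_on {a..b} f"
    using der by (meson DERIV_continuous continuous_on_eq_continuous_within)
qed

text \<open>Gronwall's argument in differential form: the squared distance times exp (-2 L t) is
  nonincreasing and starts at 0. The Lipschitz bound is asked for only on a set \<open>K\<close>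
  containing both trajectories.\<close>

lemma ode_unique_forward:
  fixes X Y :: "real \<Rightarrow> 'a::euclidean_space"
  assumes X: "\<And>t. t \<in> {a..b} \<Longrightarrow> (X has_vector_derivative F (X t)) (at t within {a..b})"
    and Y: "\<And>t. t \<in> {a..b} \<Longrightarrow> (Y has_vector_derivative F (Y t)) (at t within {a..b})"
    and K: "\<And>t. t \<in> {a..b} \<Longrightarrow> X t \<in> K" "\<And>t. t \<in> {a..b} \<Longrightarrow> Y t \<in> K"
    and lip: "\<And>x y. x \<in> K \<Longrightarrow> y \<in> K \<Longrightarrow> norm (F x - F y) \<le> L * norm (x - y)"
    and eq: "X a = Y a" and t: "t \<in> {a..b}"
  shows "X t = Y t"
proof -
  define g where "g t = ((X t - Y t) \<bullet> (X t - Y t)) * exp (- 2 * L * t)" for t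
  define g' where "g' t = (2 * ((X t - Y t) \<bullet> (F (X t) - F (Y t))) - 2 * L * ((X t - Y t) \<bullet> (X t - Y t)))
    * exp (- 2 * L * t)" for t
  have sub: "{a..t} \<subseteq> {a..b}" using t by auto
  have "g t \<le> g a"
  proof (rule nonincreasing_of_derivative_within[of a t g g'])
    show "a \<le> t" using t by simp
  next
    fix s assume s: "s \<in> {a..t}"
    then have sb: "s \<in> {a..b}" using sub by blast
    have D: "((\<lambda>s. X s - Y s) has_derivative (\<lambda>h. h *\<^sub>R (F (X s) - F (Y s)))) (at s within {a..t})"
      using has_vector_derivative_diff[OF has_vector_derivative_within_subset[OF X[OF sb] sub]
          has_vector_derivative_within_subset[OF Y[OF sb] sub]]
      by (simp add: has_vector_derivative_def)
    have "((\<lambda>s. (X s - Y s) \<bullet> (X s - Y s)) has_real_derivative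
        2 * ((X s - Y s) \<bullet> (F (X s) - F (Y s)))) (at s within {a..t})"
      unfolding has_field_derivative_def
      by (rule has_derivative_eq_rhs[OF has_derivative_inner[OF D D]])
        (auto simp: inner_commute[of "F _ - F _"])
    moreover have "((\<lambda>s. exp (- 2 * L * s)) has_real_derivative - 2 * L * exp (- 2 * L * s))
        (at s within {a..t})"
      by (auto intro!: derivative_eq_intros)
    ultimately show "(g has_real_derivative g' s) (at s within {a..t})"
      unfolding g_def[abs_def] g'_def
      by (rule DERIV_cong[OF DERIV_mult]) (simp add: left_diff_distrib)
    have "(X s - Y s) \<bullet> (F (X s) - F (Y s)) \<le> norm (X s - Y s) * norm (F (X s) - F (Y s))"
      by (rule norm_cauchy_schwarz)
    also have "\<dots> \<le> norm (X s - Y s) * (L * norm (X s - Y s))"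
      using K sb by (intro mult_left_mono lip) auto
    also have "\<dots> = L * ((X s - Y s) \<bullet> (X s - Y s))"
      by (simp add: dot_square_norm power2_eq_square)
    finally show "g' s \<le> 0"
      by (simp add: g'_def mult_le_0_iff)
  qed
  also have "g a = 0" by (simp add: g_def eq)
  finally have "(X t - Y t) \<bullet> (X t - Y t) \<le> 0"
    by (simp add: g_def mult_le_0_iff)
  then have "(X t - Y t) \<bullet> (X t - Y t) = 0" by (rule antisym) simp
  then show ?thesis by simp
qed

section \<open>Monotonicity of the traces of powers\<close>

lemma trace_scaleR: "trace (r *\<^sub>R A) = r *\<^sub>R trace A" for A :: "complex^'n^'n"
  by (simp add: trace_def scaleR_sum_right)

lemma bounded_linear_trace: "bounded_linear (trace :: complex^'n^'n \<Rightarrow> complex)"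
  by (simp add: linear_conv_bounded_linear[symmetric] linear_iff trace_add trace_scaleR)

lemma trace_commut: "trace (commut a b) = 0"
  by (simp add: commut_def trace_sub trace_mul_sym[of a b])

lemma trace_lap: "trace (lap x y a) = 0"
  by (simp add: lap_eq trace_add trace_commut)

lemma trace_unitary_conj: "unitary U \<Longrightarrow> trace (U ** A ** adj U) = trace A"
  using trace_mul_sym[of "U ** A" "adj U"] by (simp add: matrix_mul_assoc unitary_def)

lemma trace_rdiag: "trace (rdiag d) = of_real (\<Sum>i\<in>UNIV. d i)"
  by (simp add: trace_def diagm_def)

text \<open>The trace is a discrete Dirichlet form: it equals the sum over i and j of
  \<open>w i j * ((a i - a j) * (b i - b j))\<close> with weights \<open>w i j\<close> the squared
  moduli of the entries of \<open>y\<close>.\<close>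

lemma double_commut_rdiag_nonneg:
  fixes y :: "complex^'n^'n"
  assumes y: "hermitian y" and mono: "\<And>i j. (a i - a j) * (b i - b j) \<ge> (0 :: real)"
  shows "Re (trace (rdiag a ** commut y (commut y (rdiag b)))) \<ge> 0"
proof -
  define w where "w i j = (cmod (y $ i $ j))\<^sup>2" for i j
  have y_cnj: "y $ j $ i = cnj (y $ i $ j)" for i j
    using arg_cong[OF y[unfolded hermitian_def], of "\<lambda>M. M $ j $ i"] by (simp add: adj_def)
  have yy: "y $ i $ j * y $ j $ i = of_real (w i j)" for i j
    by (simp only: y_cnj[where i = i and j = j] complex_norm_square w_def)
  have w_sym: "w i j = w j i" for i j by (simp add: w_def y_cnj[where i = i and j = j])
  have C: "commut y (rdiag b) $ i $ j = y $ i $ j * (b j - b i)" for i j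
    by (simp add: commut_def diagm_mult_left diagm_mult_right algebra_simps)
  have "commut y (commut y (rdiag b)) $ i $ i = of_real (\<Sum>j\<in>UNIV. 2 * (w i j * (b i - b j)))" for i
  proof -
    have "commut y (commut y (rdiag b)) $ i $ i
        = (\<Sum>j\<in>UNIV. y $ i $ j * (y $ j $ i * (b i - b j)) - y $ i $ j * (b j - b i) * y $ j $ i)"
      unfolding commut_def[of y "commut y (rdiag b)"]
      by (simp only: vector_minus_component) (simp add: matrix_matrix_mult_def C sum_subtractf)
    also have "\<dots> = (\<Sum>j\<in>UNIV. of_real (2 * (w i j * (b i - b j))))"
    proof (rule sum.cong)
      fix j
      have "y $ i $ j * (y $ j $ i * (b i - b j)) - y $ i $ j * (b j - b i) * y $ j $ i
          = 2 * ((y $ i $ j * y $ j $ i) * (b i - b j))" by (simp add: algebra_simps)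
      then show "y $ i $ j * (y $ j $ i * (b i - b j)) - y $ i $ j * (b j - b i) * y $ j $ i
          = of_real (2 * (w i j * (b i - b j)))" by (simp add: yy)
    qed simp
    finally show ?thesis by simp
  qed
  then have tr: "Re (trace (rdiag a ** commut y (commut y (rdiag b))))
      = (\<Sum>i\<in>UNIV. a i * (\<Sum>j\<in>UNIV. 2 * (w i j * (b i - b j))))"
    by (simp only: trace_def diagm_mult_left of_real_mult[symmetric] Re_sum Re_complex_of_real)
  define S where "S = (\<Sum>i\<in>UNIV. \<Sum>j\<in>UNIV. a i * (w i j * (b i - b j)))"
  \<comment> \<open>Exchanging the two indices and using the symmetry of \<open>w\<close>; adding
    both forms of \<open>S\<close> produces the product of differences.\<close>
  have "S = (\<Sum>i\<in>UNIV. \<Sum>j\<in>UNIV. a j * (w i j * (b j - b i)))"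
    unfolding S_def by (subst sum.swap) (simp add: w_sym)
  then have "S + S = (\<Sum>i\<in>UNIV. \<Sum>j\<in>UNIV. a i * (w i j * (b i - b j)))
      + (\<Sum>i\<in>UNIV. \<Sum>j\<in>UNIV. a j * (w i j * (b j - b i)))"
    by (simp only: S_def)
  also have "\<dots> = (\<Sum>i\<in>UNIV. \<Sum>j\<in>UNIV. w i j * ((a i - a j) * (b i - b j)))"
    by (simp only: sum.distrib[symmetric]) (simp add: algebra_simps)
  finally have "S + S = (\<Sum>i\<in>UNIV. \<Sum>j\<in>UNIV. w i j * ((a i - a j) * (b i - b j)))" .
  moreover have "\<dots> \<ge> 0"
    by (intro sum_nonneg mult_nonneg_nonneg[OF _ mono]) (simp add: w_def)
  moreover have "Re (trace (rdiag a ** commut y (commut y (rdiag b)))) = S + S"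
    unfolding tr S_def by (simp add: sum_distrib_left sum.distrib[symmetric] algebra_simps)
  ultimately show ?thesis by simp
qed

text \<open>Passing to an eigenbasis replaces \<open>y\<close> by \<open>adj U ** y ** U\<close>,
  which is Hermitian whenever \<open>y\<close> is; this reduces the trace inequality to diagonal
  matrices.\<close>

lemma commut_unitary_conj:
  assumes U: "unitary U"
  shows "commut y (U ** B ** adj U) = U ** commut (adj U ** y ** U) B ** adj U"
proof -
  have UU: "U ** (adj U ** A) = A" "A ** U ** adj U = A" for A
    using U by (simp_all add: unitary_def matrix_mul_assoc)
      (simp add: matrix_mul_assoc[symmetric])
  have "U ** (adj U ** y ** U ** B) ** adj U = U ** (adj U ** (y ** (U ** B ** adj U)))"
       "U ** (B ** (adj U ** y ** U)) ** adj U = (U ** B ** adj U ** y) ** U ** adj U"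
    by (simp_all only: matrix_mul_assoc)
  then show ?thesis
    unfolding commut_def by (simp only: matmul.diff_left matmul.diff_right UU)
qed

lemma trace_mult_lap_nonneg:
  assumes U: "unitary U" and "hermitian x" "hermitian y"
    and mono: "\<And>i j. (a i - a j) * (b i - b j) \<ge> (0 :: real)"
  shows "Re (trace (U ** rdiag a ** adj U ** lap x y (U ** rdiag b ** adj U))) \<ge> 0"
proof -
  have *: "Re (trace (U ** rdiag a ** adj U ** commut z (commut z (U ** rdiag b ** adj U)))) \<ge> 0"
    if "hermitian z" for z
  proof -
    have "hermitian (adj U ** z ** U)"
      using that by (simp add: hermitian_def adj_mult matrix_mul_assoc)
    from double_commut_rdiag_nonneg[OF this mono] show ?thesis
      by (simp only: commut_unitary_conj[OF U] unitary_conj_cancel[OF U] trace_unitary_conj[OF U])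
  qed
  show ?thesis
    using *[OF assms(2)] *[OF assms(3)]
    by (simp add: lap_eq matmul.add_right trace_add)
qed

text \<open>\<open>X'\<close> and \<open>X t\<close> need not commute, so the derivative
  \<open>D\<close> has no simple closed form. Paired under the trace with some \<open>Z\<close>
  commuting with \<open>X t\<close>, all its terms coincide by cyclicity. The general
  \<open>Z\<close> is what the induction needs: the step applies the hypothesis to
  \<open>Z ** X t\<close>.\<close>

lemma has_vector_derivative_mpow:
  fixes X :: "real \<Rightarrow> complex^'n^'n"
  assumes X: "(X has_vector_derivative X') (at t within S)"
  shows "\<exists>D. ((\<lambda>t. mpow (X t) k) has_vector_derivative D) (at t within S) \<and>
    (\<forall>Z. Z ** X t = X t ** Z \<longrightarrow>
      trace (D ** Z) = of_nat k * trace (X' ** mpow (X t) (k - 1) ** Z))"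
proof (induction k)
  case 0
  show ?case by (rule exI[of _ 0]) (simp add: trace_def)
next
  case (Suc k)
  then obtain D where D: "((\<lambda>t. mpow (X t) k) has_vector_derivative D) (at t within S)"
    and tr: "\<And>Z. Z ** X t = X t ** Z \<Longrightarrow>
      trace (D ** Z) = of_nat k * trace (X' ** mpow (X t) (k - 1) ** Z)" by blast
  show ?case
  proof (intro exI[of _ "X t ** D + X' ** mpow (X t) k"] conjI allI impI)
    show "((\<lambda>t. mpow (X t) (Suc k)) has_vector_derivative X t ** D + X' ** mpow (X t) k) (at t within S)"
      using matmul.has_vector_derivative[OF X D] by simp
  next
    fix Z assume Z: "Z ** X t = X t ** Z"
    have "trace (X t ** D ** Z) = trace (D ** (Z ** X t))"
      using trace_mul_sym[of "X t" "D ** Z"] by (simp add: matrix_mul_assoc)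
    also have "\<dots> = of_nat k * trace (X' ** mpow (X t) (k - 1) ** (Z ** X t))"
    proof (rule tr)
      have "(Z ** X t) ** X t = (X t ** Z) ** X t" by (simp only: Z)
      then show "(Z ** X t) ** X t = X t ** (Z ** X t)" by (simp only: matrix_mul_assoc)
    qed
    also have "\<dots> = of_nat k * trace (X' ** mpow (X t) k ** Z)"
    proof (cases k)
      case (Suc l)
      have "mpow (X t) l ** (Z ** X t) = mpow (X t) k ** Z"
        using Suc by (simp add: Z matrix_mul_assoc mpow_commute)
      then have "X' ** (mpow (X t) l ** (Z ** X t)) = X' ** (mpow (X t) k ** Z)" by simp
      then show ?thesis using Suc by (simp only: matrix_mul_assoc) simp
    qed simp
    finally show "trace ((X t ** D + X' ** mpow (X t) k) ** Z)
        = of_nat (Suc k) * trace (X' ** mpow (X t) (Suc k - 1) ** Z)"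
      by (simp add: matmul.add_left trace_add algebra_simps)
  qed
qed

lemma has_vector_derivative_trace_mpow:
  fixes X :: "real \<Rightarrow> complex^'n^'n"
  assumes X: "(X has_vector_derivative X') (at t within S)"
  shows "((\<lambda>t. trace (mpow (X t) k)) has_vector_derivative of_nat k * trace (mpow (X t) (k - 1) ** X'))
    (at t within S)"
proof -
  obtain D where D: "((\<lambda>t. mpow (X t) k) has_vector_derivative D) (at t within S)"
    and tr: "\<And>Z. Z ** X t = X t ** Z \<Longrightarrow>
      trace (D ** Z) = of_nat k * trace (X' ** mpow (X t) (k - 1) ** Z)"
    using has_vector_derivative_mpow[OF X] by blast
  have "trace D = of_nat k * trace (mpow (X t) (k - 1) ** X')"
    using tr[of "mat 1"] trace_mul_sym[of X'] by simp
  with bounded_linear.has_vector_derivative[OF bounded_linear_trace D] show ?thesis by simp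
qed

definition contractive :: "complex^'n^'n \<Rightarrow> bool" where
  "contractive X \<longleftrightarrow> (\<exists>U d. unitary U \<and> X = U ** rdiag d ** adj U \<and> (\<forall>i. 0 \<le> d i \<and> d i < 1))"

lemma trace_mpow_rdiag_conj:
  assumes "unitary U"
  shows "Re (trace (mpow (U ** rdiag d ** adj U) k)) = (\<Sum>i\<in>UNIV. d i ^ k)"
  by (simp only: mpow_rdiag_conj[OF assms] trace_unitary_conj[OF assms] trace_rdiag Re_complex_of_real)

text \<open>Both s^k and -ln (1 - s) are nondecreasing in s on [0,1), which is the sign condition of
  \<open>trace_mult_lap_nonneg\<close> for the spectrum of \<open>X\<close>.\<close>

lemma trace_mpow_ricci_field_nonpos:
  assumes "contractive X" "hermitian x" "hermitian y" "T > 0"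
  shows "Re (trace (mpow X k ** ricci_field x y T X)) \<le> 0"
proof -
  obtain U d where U: "unitary U" "X = U ** rdiag d ** adj U" and d: "\<And>i. 0 \<le> d i" "\<And>i. d i < 1"
    using assms unfolding contractive_def by blast
  have ser: "logser X = U ** rdiag (\<lambda>i. - ln (1 - d i)) ** adj U"
    unfolding U(2) using d by (intro logser_rdiag_conj U) (auto simp: abs_less_iff intro: less_le_trans)
  have "Re (trace (mpow X k ** lap x y (logser X))) \<ge> 0"
    unfolding ser unfolding U(2) mpow_rdiag_conj[OF U(1)]
  proof (rule trace_mult_lap_nonneg[OF U(1) assms(2,3)])
    have *: "(d i ^ k - d j ^ k) * (- ln (1 - d i) - - ln (1 - d j)) \<ge> 0" if "d j \<le> d i" for i j
      using that d by (intro mult_nonneg_nonneg) (auto intro: power_mono)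
    show "(d i ^ k - d j ^ k) * (- ln (1 - d i) - - ln (1 - d j)) \<ge> 0" for i j
    proof (cases "d j \<le> d i")
      case False
      then show ?thesis using *[of i j] by (simp add: algebra_simps)
    qed (rule *)
  qed
  then show ?thesis
    using \<open>T > 0\<close> by (simp add: ricci_field_def matmul.scaleR_right matmul.minus_right trace_scaleR
        linear_neg[OF bounded_linear.linear[OF bounded_linear_trace]])
qed

text \<open>The eigenvalues of \<open>X0\<close> are below 1, so the trace of its k-th power tends
  to 0; \<open>k\<close> is taken so large that this trace, \<open>E\<close>, is below 1. For any
  admissible \<open>X\<close> each eigenvalue to the power \<open>k\<close> is at most
  \<open>E\<close>, hence each eigenvalue is at most \<open>root k E\<close>. Both \<open>k\<close>
  and the bound come from \<open>X0\<close> alone.\<close>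

lemma contractive_uniform_bound:
  fixes X0 :: "complex^'n^'n"
  assumes "contractive X0"
  obtains k r where "0 \<le> r" "r < 1"
    "\<And>X :: complex^'n^'n. contractive X \<Longrightarrow> Re (trace (mpow X k)) \<le> Re (trace (mpow X0 k)) \<Longrightarrow> opnorm_le X r"
proof -
  obtain U d where U: "unitary U" "X0 = U ** rdiag d ** adj U" and d: "\<And>i. 0 \<le> d i" "\<And>i. d i < 1"
    using assms unfolding contractive_def by blast
  have "(\<lambda>k. \<Sum>i\<in>UNIV. d i ^ k) \<longlonglongrightarrow> (\<Sum>i\<in>(UNIV :: 'n set). 0)"
    using d by (intro tendsto_sum LIMSEQ_power_zero) auto
  then have "\<forall>\<^sub>F k in sequentially. (\<Sum>i\<in>UNIV. d i ^ k) < 1"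
    by (intro order_tendstoD(2)[where y = 0]) auto
  moreover have "\<forall>\<^sub>F k in sequentially. k > 0" by (rule eventually_gt_at_top)
  ultimately have "\<forall>\<^sub>F k in sequentially. (\<Sum>i\<in>UNIV. d i ^ k) < 1 \<and> k > 0"
    by (rule eventually_conj)
  then obtain k where k: "(\<Sum>i\<in>UNIV. d i ^ k) < 1" "k > 0"
    by (auto simp: eventually_sequentially)
  define E where "E = (\<Sum>i\<in>UNIV. d i ^ k)"
  have E: "0 \<le> E" "E < 1" "Re (trace (mpow X0 k)) = E"
    using d k by (auto simp: E_def U(2) trace_mpow_rdiag_conj[OF U(1)] intro: sum_nonneg)
  show ?thesis
  proof (rule that[of "root k E" k])
    show "0 \<le> root k E" "root k E < 1" using E k by simp_all
    fix X :: "complex^'n^'n"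
    assume X: "contractive X" "Re (trace (mpow X k)) \<le> Re (trace (mpow X0 k))"
    then obtain V e where V: "unitary V" "X = V ** rdiag e ** adj V" and e: "\<And>i. 0 \<le> e i"
      unfolding contractive_def by blast
    have "\<bar>e i\<bar> \<le> root k E" for i
    proof -
      have "e i ^ k \<le> (\<Sum>i\<in>UNIV. e i ^ k)"
        using e by (intro member_le_sum) auto
      also have "\<dots> \<le> E"
        using X(2) unfolding V(2) trace_mpow_rdiag_conj[OF V(1)] E(3) .
      finally have "root k (e i ^ k) \<le> root k E" using k by simp
      then show ?thesis using e[of i] k by (simp add: real_root_power_cancel)
    qed
    then show "opnorm_le X (root k E)"
      unfolding V(2) by (intro opnorm_le_rdiag_conj V(1))
  qed
qed

section \<open>Local solutions\<close>

lemma has_vector_derivative_matrix_iff: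
  fixes X :: "real \<Rightarrow> complex^'n^'n"
  shows "(X has_vector_derivative D) (at t within S) \<longleftrightarrow>
    (\<forall>i j. ((\<lambda>s. X s $ i $ j) has_vector_derivative D $ i $ j) (at t within S))"
proof
  assume X: "(X has_vector_derivative D) (at t within S)"
  show "\<forall>i j. ((\<lambda>s. X s $ i $ j) has_vector_derivative D $ i $ j) (at t within S)"
    by (intro allI bounded_linear.has_vector_derivative[OF
        bounded_linear_compose[OF bounded_linear_vec_nth bounded_linear_vec_nth] X])
next
  assume *: "\<forall>i j. ((\<lambda>s. X s $ i $ j) has_vector_derivative D $ i $ j) (at t within S)"
  show "(X has_vector_derivative D) (at t within S)"
    unfolding has_vector_derivative_def has_derivative_within
  proof
    show "bounded_linear (\<lambda>x. x *\<^sub>R D)" by (rule bounded_linear_scaleR_left)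
    show "((\<lambda>y. (1 / norm (y - t)) *\<^sub>R (X y - (X t + (y - t) *\<^sub>R D))) \<longlongrightarrow> 0) (at t within S)"
    proof (intro vec_tendstoI)
      fix i j
      have "((\<lambda>y. (1 / norm (y - t)) *\<^sub>R (X y $ i $ j - (X t $ i $ j + (y - t) *\<^sub>R D $ i $ j))) \<longlongrightarrow> 0)
          (at t within S)"
        using * unfolding has_vector_derivative_def has_derivative_within by blast
      then show "((\<lambda>y. ((1 / norm (y - t)) *\<^sub>R (X y - (X t + (y - t) *\<^sub>R D))) $ i $ j) \<longlongrightarrow> 0 $ i $ j)
          (at t within S)"
        by simp
    qed
  qed
qed

lemma hermitian_opnorm_diagonalization:
  assumes X: "hermitian X" "opnorm_le X s"
  obtains U d where "unitary U" "X = U ** rdiag d ** adj U" "\<And>i. \<bar>d i\<bar> \<le> s"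
proof -
  obtain U d where U: "unitary U" "X = U ** rdiag d ** adj U"
    using hermitian_diagonalization[OF X(1)] by blast
  have "\<bar>d i\<bar> \<le> s" for i
  proof -
    obtain w where w: "w \<noteq> 0" "X *v w = complex_of_real (d i) *s w"
      using is_eigenvalue_rdiag_conj[OF U(1), of d i] U(2) by (auto simp: is_eigenvalue_def)
    have "complex_of_real (d i) *s w = d i *\<^sub>R w"
      by (simp add: vec_eq_iff scaleR_conv_of_real[where 'a=complex])
    then have "\<bar>d i\<bar> * norm w \<le> s * norm w"
      using X(2) w(2) unfolding opnorm_le_def by (metis norm_scaleR)
    then show ?thesis using w(1) by simp
  qed
  with U that show ?thesis by blast
qed

lemma posdef_rdiag_conj:
  assumes U: "unitary U" and d: "\<And>i. d i > 0"
  shows "U ** rdiag d ** adj U \<in> posdef_set"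
  unfolding posdef_set_def
proof (intro CollectI conjI allI impI hermitian_rdiag_conj)
  fix e assume "is_eigenvalue (U ** rdiag d ** adj U) e"
  then obtain w where w: "w \<noteq> 0" "(U ** rdiag d ** adj U) *v w = e *s w"
    by (auto simp: is_eigenvalue_def)
  define v where "v = adj U *v w"
  have "norm v = norm w" unfolding v_def by (intro norm_unitary unitary_adj U)
  with w(1) have "v \<noteq> 0" by auto
  then obtain i where i: "v $ i \<noteq> 0" by (auto simp: vec_eq_iff)
  have "rdiag d *v v = (adj U ** U ** rdiag d) *v v"
    using U by (simp add: unitary_def)
  also have "\<dots> = adj U *v ((U ** rdiag d ** adj U) *v w)"
    by (simp add: v_def matrix_vector_mul_assoc matrix_mul_assoc)
  also have "\<dots> = e *s v"
    by (simp add: w(2) vector_scalar_commute v_def)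
  finally have "(rdiag d *v v) $ i = e * v $ i" by simp
  moreover have "(rdiag d *v v) $ i = complex_of_real (d i) * v $ i"
    unfolding matrix_vector_mult_def[of "rdiag d"]
    by (simp add: diagm_def if_distribR if_distrib[of "\<lambda>x. x * _"] cong: if_cong)
  ultimately have "e = complex_of_real (d i)" using i by simp
  then show "e \<in> \<real>" "Re e > 0" using d[of i] by simp_all
qed

text \<open>The way back from X to the metric. The spectrum of \<open>X\<close> may here be
  negative: local solutions are only known to be Hermitian with spectral norm at most
  \<open>s\<close>, and this already makes the metric positive.\<close>

lemma posdef_of_opnorm:
  assumes "hermitian X" "opnorm_le X s" "s < 1" "T > 0"
  shows "T *\<^sub>R (mat 1 - X) \<in> posdef_set"
    and "mlog (T *\<^sub>R (mat 1 - X)) = ln T *\<^sub>R mat 1 - logser X"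
proof -
  obtain U d where U: "unitary U" "X = U ** rdiag d ** adj U" and d: "\<And>i. \<bar>d i\<bar> \<le> s"
    using hermitian_opnorm_diagonalization[OF assms(1,2)] by blast
  have d1: "\<bar>d i\<bar> < 1" for i using d[of i] \<open>s < 1\<close> by simp
  show "mlog (T *\<^sub>R (mat 1 - X)) = ln T *\<^sub>R mat 1 - logser X"
    by (rule mlog_eq_logser[OF U(1) d1 \<open>T > 0\<close> U(2)])
  have "mat 1 = U ** rdiag (\<lambda>i. 1) ** adj U"
    using U by (simp add: diagm_one unitary_def)
  then have "T *\<^sub>R (mat 1 - X) = U ** (T *\<^sub>R (rdiag (\<lambda>i. 1) - rdiag d)) ** adj U"
    unfolding U(2)
    by (simp only: matmul.scaleR_left matmul.scaleR_right matmul.diff_left matmul.diff_right)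
  also have "T *\<^sub>R (rdiag (\<lambda>i. 1) - rdiag d) = rdiag (\<lambda>i. T * (1 - d i))"
    by (auto simp: diagm_def vec_eq_iff scaleR_conv_of_real[where 'a=complex])
  finally have eq: "T *\<^sub>R (mat 1 - X) = U ** rdiag (\<lambda>i. T * (1 - d i)) ** adj U" .
  have "T * (1 - d i) > 0" for i using d1[of i] \<open>T > 0\<close> by simp
  then show "T *\<^sub>R (mat 1 - X) \<in> posdef_set"
    unfolding eq by (intro posdef_rdiag_conj U(1))
qed

lemma contractive_of_posdef:
  fixes c :: "complex^'n^'n"
  assumes "c \<in> posdef_set" and T: "trace c = complex_of_real T"
  shows "contractive (mat 1 - (1 / T) *\<^sub>R c)" and "T > 0"
proof -
  obtain U d where U: "unitary U" "c = U ** rdiag d ** adj U" and d: "\<And>i. d i > 0"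
    using posdef_diagonalization[OF assms(1)] by blast
  have sum: "T = (\<Sum>i\<in>UNIV. d i)"
    using T unfolding U(2) trace_unitary_conj[OF U(1)] trace_rdiag by (simp only: of_real_eq_iff)
  have le: "d i \<le> T" for i
    unfolding sum using less_imp_le[OF d] by (intro member_le_sum) auto
  show "T > 0" using less_le_trans[OF d le] .
  have "mat 1 = U ** rdiag (\<lambda>i. 1) ** adj U"
    using U by (simp add: diagm_one unitary_def)
  then have "mat 1 - (1 / T) *\<^sub>R c = U ** (rdiag (\<lambda>i. 1) - (1 / T) *\<^sub>R rdiag d) ** adj U"
    unfolding U(2)
    by (simp only: matmul.scaleR_left matmul.scaleR_right matmul.diff_left matmul.diff_right)
  also have "rdiag (\<lambda>i. 1) - (1 / T) *\<^sub>R rdiag d = rdiag (\<lambda>i. 1 - d i / T)"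
    by (auto simp: diagm_def vec_eq_iff scaleR_conv_of_real[where 'a=complex])
  finally have "mat 1 - (1 / T) *\<^sub>R c = U ** rdiag (\<lambda>i. 1 - d i / T) ** adj U" .
  moreover have "0 \<le> 1 - d i / T \<and> 1 - d i / T < 1" for i
    using d[of i] le[of i] \<open>T > 0\<close> by simp
  ultimately show "contractive (mat 1 - (1 / T) *\<^sub>R c)"
    unfolding contractive_def
    by (intro exI[of _ U] exI[of _ "\<lambda>i. 1 - d i / T"] conjI U(1) allI) auto
qed

text \<open>The squared norm of \<open>adj A *v w\<close> is the inner product of
  \<open>A *v (adj A *v w)\<close> with \<open>w\<close>; Cauchy-Schwarz then gives the bound after
  cancelling one factor.\<close>

lemma opnorm_le_adj:
  assumes A: "opnorm_le A s" and "0 \<le> s"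
  shows "opnorm_le (adj A) s"
  unfolding opnorm_le_def
proof
  fix w
  let ?v = "adj A *v w"
  have "norm ?v * norm ?v = (A *v ?v) \<bullet> w"
    by (simp add: inner_adj dot_square_norm power2_eq_square)
  also have "\<dots> \<le> norm (A *v ?v) * norm w" by (rule norm_cauchy_schwarz)
  also have "\<dots> \<le> s * norm ?v * norm w"
    using A by (intro mult_right_mono) (auto simp: opnorm_le_def)
  finally have "norm ?v * norm ?v \<le> norm ?v * (s * norm w)" by (simp add: mult_ac)
  then show "norm ?v \<le> s * norm w"
    using \<open>0 \<le> s\<close> by (cases "norm ?v = 0") (auto simp: mult_le_cancel_left)
qed

lemma opnorm_le_ball:
  assumes "opnorm_le X0 r" "\<And>A :: complex^'n^'n. opnorm_le A (K * norm A)"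
    "norm (X - X0) \<le> \<delta>" "K > 0" "r + K * \<delta> \<le> s"
  shows "opnorm_le (X :: complex^'n^'n) s"
proof -
  have "opnorm_le (X0 + (X - X0)) (r + K * norm (X - X0))"
    by (intro opnorm_le_add assms)
  moreover have "K * norm (X - X0) \<le> K * \<delta>"
    using assms(3,4) by (intro mult_left_mono) auto
  ultimately show ?thesis
    using assms(5) by (auto elim!: opnorm_le_mono)
qed

text \<open>The radius \<open>\<eta>\<close> is fixed before \<open>X0\<close> is chosen. This
  uniformity is what allows continuation by equal time steps.\<close>

lemma ricci_field_local_solution:
  fixes x y :: "complex^'n^'n"
  assumes "0 \<le> r" "r < s" "s < 1"
  obtains \<eta> where "\<eta> > 0"
    "\<And>X0. opnorm_le X0 r \<Longrightarrow> \<exists>X. X 0 = X0 \<and> (\<forall>z\<in>ball 0 \<eta>. opnorm_le (X z) s \<and>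
       (\<forall>i j. ((\<lambda>w. X w $ i $ j) has_field_derivative ricci_field x y T (X z) $ i $ j) (at z)))"
proof -
  let ?F = "ricci_field x y T"
  let ?N = "(real CARD('n))\<^sup>2"
  have s: "0 \<le> s" using assms by simp
  obtain K where K: "K > 0" "\<And>A :: complex^'n^'n. opnorm_le A (K * norm A)"
    using opnorm_le_norm by blast
  obtain L where L: "L \<ge> 0" "\<And>X Y. opnorm_le X s \<Longrightarrow> opnorm_le Y s \<Longrightarrow>
       norm (?F X - ?F Y) \<le> L * norm (X - Y)"
    using ricci_field_lipschitz[OF s \<open>s < 1\<close>] by blast
  \<comment> \<open>The norm ball of radius \<open>\<delta>\<close> around a matrix of spectral norm
    at most \<open>r\<close> stays in the region of spectral norm at most \<open>s\<close>.\<close>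
  define \<delta> where "\<delta> = (s - r) / K"
  have \<delta>: "\<delta> > 0" "r + K * \<delta> \<le> s" using assms K by (simp_all add: \<delta>_def)
  define B where "B = norm (?F 0) + L * (?N * s)"
  have B0: "B \<ge> 0" using L s by (simp add: B_def)
  have bd: "norm (?F X) \<le> B" if "opnorm_le X s" for X
  proof -
    have "norm (?F X - ?F 0) \<le> L * norm (X - 0)"
      using that s by (intro L) (auto simp: opnorm_le_def)
    also have "\<dots> \<le> L * (?N * s)"
      using norm_le_opnorm[OF that] L(1) by (intro mult_left_mono) auto
    finally show ?thesis
      using norm_triangle_ineq2[of "?F X" "?F 0"] by (simp add: B_def)
  qed
  \<comment> \<open>The two terms realize the two smallness conditions of the iteration; adding 1
    keeps the denominators positive even if \<open>B\<close> or \<open>L\<close> is 0.\<close>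
  define \<eta> where "\<eta> = min (\<delta> / (?N * B + 1)) (1 / (2 * (?N * L + 1)))"
  have pos: "?N * B + 1 > 0" "?N * L + 1 > 0"
    using B0 L(1) by (simp_all add: add_nonneg_pos)
  have "\<eta> > 0" using \<delta>(1) pos by (simp add: \<eta>_def)
  have small: "?N * (B * \<eta>) \<le> \<delta>" "?N * (L * \<eta>) \<le> 1 / 2"
  proof -
    have "\<eta> * (?N * B + 1) \<le> \<delta>" "\<eta> * (2 * (?N * L + 1)) \<le> 1"
      using pos by (simp_all add: \<eta>_def min_le_iff_disj flip: pos_le_divide_eq)
    then show "?N * (B * \<eta>) \<le> \<delta>" "?N * (L * \<eta>) \<le> 1 / 2"
      using \<open>\<eta> > 0\<close> by (simp_all add: algebra_simps)
  qed
  show ?thesis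
  proof (rule that[OF \<open>\<eta> > 0\<close>])
    fix X0 :: "complex^'n^'n" assume X0: "opnorm_le X0 r"
    have op: "opnorm_le X s" if "norm (X - X0) \<le> \<delta>" for X
      using opnorm_le_ball[OF X0 K(2) that K(1) \<delta>(2)] .
    obtain X where X: "X 0 = X0" "\<And>z. z \<in> ball 0 \<eta> \<Longrightarrow> norm (X z - X0) \<le> \<delta>"
      "\<And>z i j. z \<in> ball 0 \<eta> \<Longrightarrow> ((\<lambda>w. X w $ i $ j) has_field_derivative ?F (X z) $ i $ j) (at z)"
    proof (rule holomorphic_picard[OF \<open>\<eta> > 0\<close> less_imp_le[OF \<delta>(1)] L(1) _ _ _ small])
      show "norm (?F X) \<le> B" if "norm (X - X0) \<le> \<delta>" for X
        using bd op that by blast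
      show "norm (?F X - ?F Y) \<le> L * norm (X - Y)"
        if "norm (X - X0) \<le> \<delta>" "norm (Y - X0) \<le> \<delta>" for X Y
        using L op that by blast
      show "mat_holomorphic (\<lambda>z. ?F (X z)) (ball 0 \<eta>)"
        if "mat_holomorphic X (ball 0 \<eta>)" "\<And>z. z \<in> ball 0 \<eta> \<Longrightarrow> norm (X z - X0) \<le> \<delta>" for X
        by (rule mat_holomorphic_ricci_field[OF that(1) open_ball op[OF that(2)] s \<open>s < 1\<close>])
    qed blast
    show "\<exists>X. X 0 = X0 \<and> (\<forall>z\<in>ball 0 \<eta>. opnorm_le (X z) s \<and>
       (\<forall>i j. ((\<lambda>w. X w $ i $ j) has_field_derivative ?F (X z) $ i $ j) (at z)))"
      using X op by blast
  qed
qed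

section \<open>The flow\<close>

lemma contractive_hermitian: "contractive X \<Longrightarrow> hermitian X"
  unfolding contractive_def using hermitian_rdiag_conj by blast

locale ricci_flow =
  fixes x y c0 :: "complex^'n^'n" and t0 :: real
  assumes x: "hermitian x" and y: "hermitian y" and c0: "c0 \<in> posdef_set"
begin

definition T :: real where "T = Re (trace c0)"

definition coord :: "complex^'n^'n \<Rightarrow> complex^'n^'n" where
  "coord c = mat 1 - (1 / T) *\<^sub>R c"

text \<open>The working form of \<open>ricci_sol\<close>, with a matrix-valued derivative prescribed
  by the equation; continuity of this derivative is recovered in
  \<open>flow_imp_ricci_sol\<close>.\<close>

definition flow :: "real set \<Rightarrow> (real \<Rightarrow> complex^'n^'n) \<Rightarrow> bool" where
  "flow S c \<longleftrightarrow> c t0 = c0 \<and> (\<forall>t\<in>S. c t \<in> posdef_set \<and>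
     (c has_vector_derivative - lap x y (mlog (c t))) (at t within S))"

lemma trace_c0: "trace c0 = complex_of_real T"
proof -
  obtain U d where U: "unitary U" "c0 = U ** rdiag d ** adj U"
    using posdef_diagonalization[OF c0] by blast
  have "trace c0 = complex_of_real (\<Sum>i\<in>UNIV. d i)"
    unfolding U(2) trace_unitary_conj[OF U(1)] trace_rdiag ..
  then show ?thesis by (simp add: T_def)
qed

lemma T_pos: "T > 0"
  by (rule contractive_of_posdef(2)[OF c0 trace_c0])

lemma coord_inverse: "T *\<^sub>R (mat 1 - coord c) = c"
  using T_pos by (simp add: coord_def)

lemma flow_subset:
  assumes "flow S c" "S' \<subseteq> S"
  shows "flow S' c"
  using assms unfolding flow_def by (meson has_vector_derivative_within_subset subsetD)

lemma flow_trace: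
  assumes c: "flow {t0..t1} c" and t: "t \<in> {t0..t1}"
  shows "trace (c t) = complex_of_real T"
proof -
  have "((\<lambda>t. trace (c t)) has_vector_derivative 0) (at s within {t0..t1})" if "s \<in> {t0..t1}" for s
  proof -
    have "(c has_vector_derivative - lap x y (mlog (c s))) (at s within {t0..t1})"
      using c that by (simp add: flow_def)
    from bounded_linear.has_vector_derivative[OF bounded_linear_trace this] show ?thesis
      by (simp add: linear_neg[OF bounded_linear.linear[OF bounded_linear_trace]] trace_lap)
  qed
  then obtain k where k: "\<And>s. s \<in> {t0..t1} \<Longrightarrow> trace (c s) = k"
    using has_vector_derivative_zero_constant[of "{t0..t1}"] by (metis convex_closed_interval)
  have "trace (c t) = trace (c t0)" using k[OF t] k[of t0] t by simp
  with c show ?thesis by (simp add: flow_def trace_c0)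
qed

lemma flow_coord:
  assumes c: "flow {t0..t1} c" and t: "t \<in> {t0..t1}"
  shows "contractive (coord (c t))"
    and "((\<lambda>t. coord (c t)) has_vector_derivative ricci_field x y T (coord (c t))) (at t within {t0..t1})"
proof -
  have ct: "c t \<in> posdef_set" using c t by (simp add: flow_def)
  show con: "contractive (coord (c t))"
    unfolding coord_def by (rule contractive_of_posdef(1)[OF ct flow_trace[OF c t]])
  then obtain U d where U: "unitary U" "coord (c t) = U ** rdiag d ** adj U"
    and d: "\<And>i. 0 \<le> d i" "\<And>i. d i < 1" unfolding contractive_def by blast
  have "mlog (c t) = ln T *\<^sub>R mat 1 - logser (coord (c t))"
    using mlog_eq_logser[OF U(1) _ T_pos U(2)] d by (simp add: coord_inverse)
  then have lap: "lap x y (mlog (c t)) = - lap x y (logser (coord (c t)))"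
    by (simp add: linear_diff[OF bounded_linear.linear[OF bounded_linear_lap]] lap_scalar)
  have "(c has_vector_derivative - lap x y (mlog (c t))) (at t within {t0..t1})"
    using c t by (simp add: flow_def)
  then have "(c has_vector_derivative lap x y (logser (coord (c t)))) (at t within {t0..t1})"
    by (simp add: lap)
  from has_vector_derivative_diff[OF has_vector_derivative_const
      bounded_linear.has_vector_derivative[OF bounded_linear_scaleR_right this, of "1 / T"], of "mat 1"]
  show "((\<lambda>t. coord (c t)) has_vector_derivative ricci_field x y T (coord (c t))) (at t within {t0..t1})"
    by (simp add: coord_def[abs_def] ricci_field_def)
qed

lemma flow_derivative_of_coord:
  assumes X: "(X has_vector_derivative ricci_field x y T (X t)) (at t within S)"
    and "hermitian (X t)" "opnorm_le (X t) s" "s < 1"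
  shows "T *\<^sub>R (mat 1 - X t) \<in> posdef_set"
    and "((\<lambda>t. T *\<^sub>R (mat 1 - X t)) has_vector_derivative
      - lap x y (mlog (T *\<^sub>R (mat 1 - X t)))) (at t within S)"
proof -
  show "T *\<^sub>R (mat 1 - X t) \<in> posdef_set"
    by (rule posdef_of_opnorm(1)[OF assms(2-4) T_pos])
  have log: "mlog (T *\<^sub>R (mat 1 - X t)) = ln T *\<^sub>R mat 1 - logser (X t)"
    by (rule posdef_of_opnorm(2)[OF assms(2-4) T_pos])
  have eq: "T *\<^sub>R (0 - ricci_field x y T (X t)) = - lap x y (mlog (T *\<^sub>R (mat 1 - X t)))"
    unfolding log using T_pos
    by (simp add: ricci_field_def linear_diff[OF bounded_linear.linear[OF bounded_linear_lap]] lap_scalar)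
  show "((\<lambda>t. T *\<^sub>R (mat 1 - X t)) has_vector_derivative
      - lap x y (mlog (T *\<^sub>R (mat 1 - X t)))) (at t within S)"
    unfolding eq[symmetric]
    by (rule bounded_linear.has_vector_derivative[OF bounded_linear_scaleR_right
        has_vector_derivative_diff[OF has_vector_derivative_const X]])
qed

text \<open>The a priori estimate: \<open>r\<close> is obtained from \<open>c0\<close> alone, before
  any solution or end time is given. It serves uniqueness, continuation, analyticity and continuity
  of the derivative.\<close>

lemma flow_uniform_bound:
  obtains r where "0 \<le> r" "r < 1"
    "\<And>t1 c t. flow {t0..t1} c \<Longrightarrow> t \<in> {t0..t1} \<Longrightarrow> opnorm_le (coord (c t)) r"
proof -
  have "contractive (coord c0)"
    unfolding coord_def by (rule contractive_of_posdef(1)[OF c0 trace_c0])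
  then obtain k r where r: "0 \<le> r" "r < 1"
    and bd: "\<And>X :: complex^'n^'n. contractive X \<Longrightarrow>
      Re (trace (mpow X k)) \<le> Re (trace (mpow (coord c0) k)) \<Longrightarrow> opnorm_le X r"
    using contractive_uniform_bound by blast
  have "opnorm_le (coord (c t)) r" if c: "flow {t0..t1} c" and t: "t \<in> {t0..t1}" for t1 c t
  proof (rule bd[OF flow_coord(1)[OF c t]])
    have ct: "flow {t0..t} c" using t by (intro flow_subset[OF c]) auto
    let ?E = "\<lambda>t. Re (trace (mpow (coord (c t)) k))"
    let ?E' = "\<lambda>t. real k * Re (trace (mpow (coord (c t)) (k - 1) ** ricci_field x y T (coord (c t))))"
    have "?E t \<le> ?E t0"
    proof (rule nonincreasing_of_derivative_within[where f = ?E and f' = ?E'])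
      show "t0 \<le> t" using t by simp
      fix s assume s: "s \<in> {t0..t}"
      have "(?E has_vector_derivative ?E' s) (at s within {t0..t})"
        using bounded_linear.has_vector_derivative[OF bounded_linear_Re
            has_vector_derivative_trace_mpow[OF flow_coord(2)[OF ct s], of k]]
        by simp
      then show "(?E has_real_derivative ?E' s) (at s within {t0..t})"
        by (simp add: has_real_derivative_iff_has_vector_derivative)
      show "?E' s \<le> 0"
        using trace_mpow_ricci_field_nonpos[OF flow_coord(1)[OF ct s] x y T_pos]
        by (intro mult_nonneg_nonpos) auto
    qed
    then show "?E t \<le> Re (trace (mpow (coord c0) k))"
      using c by (simp add: flow_def)
  qed
  with r that show ?thesis by blast
qed

lemma flow_unique:
  assumes c1: "flow {t0..t1} c1" and c2: "flow {t0..t1} c2" and t: "t \<in> {t0..t1}"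
  shows "c1 t = c2 t"
proof -
  obtain r where r: "0 \<le> r" "r < 1"
    and bd: "\<And>t1 c t. flow {t0..t1} c \<Longrightarrow> t \<in> {t0..t1} \<Longrightarrow> opnorm_le (coord (c t)) r"
    using flow_uniform_bound by blast
  obtain L where lip: "\<And>X Y. opnorm_le X r \<Longrightarrow> opnorm_le Y r \<Longrightarrow>
       norm (ricci_field x y T X - ricci_field x y T Y) \<le> L * norm (X - Y)"
    using ricci_field_lipschitz[OF r] by blast
  have "coord (c1 t) = coord (c2 t)"
  proof (rule ode_unique_forward[where K = "{X. opnorm_le X r}", OF flow_coord(2)[OF c1] flow_coord(2)[OF c2]])
    show "coord (c1 t0) = coord (c2 t0)" using c1 c2 by (simp add: flow_def)
  qed (use t bd c1 c2 lip in auto)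
  then show ?thesis by (metis coord_inverse)
qed

text \<open>The holomorphic solution restricted to the real axis and translated to start at
  \<open>t1\<close>. Derivatives are stated within an arbitrary \<open>S\<close> so that they can be
  used on one-sided intervals.\<close>

lemma local_solution:
  assumes "0 \<le> r" "r < s" "s < 1"
  obtains \<eta> where "\<eta> > 0"
    "\<And>X0 t1. opnorm_le X0 r \<Longrightarrow> \<exists>X. X 0 = X0 \<and>
      (\<forall>z\<in>ball 0 \<eta>. opnorm_le (X z) s) \<and> mat_holomorphic X (ball 0 \<eta>) \<and>
      (\<forall>t S. \<bar>t - t1\<bar> < \<eta> \<longrightarrow> ((\<lambda>t. X (complex_of_real (t - t1))) has_vector_derivative
         ricci_field x y T (X (complex_of_real (t - t1)))) (at t within S))"
proof -
  obtain \<eta> where \<eta>: "\<eta> > 0"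
    "\<And>X0. opnorm_le X0 r \<Longrightarrow> \<exists>X. X 0 = X0 \<and> (\<forall>z\<in>ball 0 \<eta>. opnorm_le (X z) s \<and>
       (\<forall>i j. ((\<lambda>w. X w $ i $ j) has_field_derivative ricci_field x y T (X z) $ i $ j) (at z)))"
    using ricci_field_local_solution[OF assms] by blast
  show ?thesis
  proof (rule that[OF \<eta>(1)])
    fix X0 :: "complex^'n^'n" and t1 :: real assume "opnorm_le X0 r"
    from \<eta>(2)[OF this] obtain X where X: "X 0 = X0" "\<And>z. z \<in> ball 0 \<eta> \<Longrightarrow> opnorm_le (X z) s"
      "\<And>z i j. z \<in> ball 0 \<eta> \<Longrightarrow>
        ((\<lambda>w. X w $ i $ j) has_field_derivative ricci_field x y T (X z) $ i $ j) (at z)" by blast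
    have "mat_holomorphic X (ball 0 \<eta>)"
      unfolding mat_holomorphic_def holomorphic_on_open[OF open_ball] using X(3) by blast
    moreover have "((\<lambda>t. X (complex_of_real (t - t1))) has_vector_derivative
         ricci_field x y T (X (complex_of_real (t - t1)))) (at t within S)" if "\<bar>t - t1\<bar> < \<eta>" for t S
    proof (unfold has_vector_derivative_matrix_iff, intro allI)
      fix i j
      have "complex_of_real (t - t1) \<in> ball 0 \<eta>" using that by (simp del: of_real_diff)
      note der = X(3)[OF this, of i j]
      have sh: "((\<lambda>t. complex_of_real (t - t1)) has_vector_derivative 1) (at t)"
        by (auto intro!: derivative_eq_intros simp: has_vector_derivative_def scaleR_conv_of_real)
      have "((\<lambda>w. X w $ i $ j) \<circ> (\<lambda>t. complex_of_real (t - t1)) has_vector_derivative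
          1 * ricci_field x y T (X (complex_of_real (t - t1))) $ i $ j) (at t)"
        by (rule field_vector_diff_chain_at[OF sh der])
      then show "((\<lambda>t. X (complex_of_real (t - t1)) $ i $ j) has_vector_derivative
          ricci_field x y T (X (complex_of_real (t - t1))) $ i $ j) (at t within S)"
        by (simp add: o_def has_vector_derivative_at_within)
    qed
    ultimately show "\<exists>X. X 0 = X0 \<and>
      (\<forall>z\<in>ball 0 \<eta>. opnorm_le (X z) s) \<and> mat_holomorphic X (ball 0 \<eta>) \<and>
      (\<forall>t S. \<bar>t - t1\<bar> < \<eta> \<longrightarrow> ((\<lambda>t. X (complex_of_real (t - t1))) has_vector_derivative
         ricci_field x y T (X (complex_of_real (t - t1)))) (at t within S))"
      using X by blast
  qed
qed

text \<open>By uniqueness, a solution starting at a Hermitian matrix coincides with its adjoint.\<close>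

lemma ricci_field_solution_hermitian:
  fixes X :: "real \<Rightarrow> complex^'n^'n"
  assumes X: "\<And>t. t \<in> {a..b} \<Longrightarrow> (X has_vector_derivative ricci_field x y T (X t)) (at t within {a..b})"
    and bd: "\<And>t. t \<in> {a..b} \<Longrightarrow> opnorm_le (X t) s" and s: "0 \<le> s" "s < 1"
    and "hermitian (X a)" and t: "t \<in> {a..b}"
  shows "hermitian (X t)"
proof -
  obtain L where lip: "\<And>X Y. opnorm_le X s \<Longrightarrow> opnorm_le Y s \<Longrightarrow>
       norm (ricci_field x y T X - ricci_field x y T Y) \<le> L * norm (X - Y)"
    using ricci_field_lipschitz[OF s] by blast
  have "adj (X t) = X t"
  proof (rule ode_unique_forward[where K = "{X. opnorm_le X s}" and F = "ricci_field x y T"])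
    fix t assume t: "t \<in> {a..b}"
    show "((\<lambda>t. adj (X t)) has_vector_derivative ricci_field x y T (adj (X t))) (at t within {a..b})"
      using bounded_linear.has_vector_derivative[OF bounded_linear_adj X[OF t]]
      by (simp add: adj_ricci_field[OF x y bd[OF t] s])
    show "adj (X t) \<in> {X. opnorm_le X s}" "X t \<in> {X. opnorm_le X s}"
      using opnorm_le_adj[OF bd[OF t] s(1)] bd[OF t] by simp_all
  qed (use X lip t \<open>hermitian (X a)\<close> in \<open>auto simp: hermitian_def\<close>)
  then show ?thesis by (simp add: hermitian_def)
qed

text \<open>The gain \<open>\<epsilon>\<close> depends on the a priori bound only, not on
  \<open>t1\<close> or \<open>c\<close>, so finitely many extensions reach any time.\<close>

lemma flow_extend:
  obtains \<epsilon> where "\<epsilon> > 0" "\<And>t1 c. t0 \<le> t1 \<Longrightarrow> flow {t0..t1} c \<Longrightarrow> \<exists>c'. flow {t0..t1 + \<epsilon>} c'"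
proof -
  obtain r where r: "0 \<le> r" "r < 1"
    and bd: "\<And>t1 c t. flow {t0..t1} c \<Longrightarrow> t \<in> {t0..t1} \<Longrightarrow> opnorm_le (coord (c t)) r"
    using flow_uniform_bound by blast
  \<comment> \<open>The midpoint leaves room on both sides: above \<open>r\<close> for a ball in
    which to iterate, below 1 for convergence of the logarithm series.\<close>
  define s where "s = (r + 1) / 2"
  have s: "0 \<le> s" "r < s" "s < 1" using r by (simp_all add: s_def)
  obtain \<eta> where \<eta>: "\<eta> > 0"
    and loc: "\<And>X0 t1. opnorm_le X0 r \<Longrightarrow> \<exists>X. X 0 = X0 \<and>
      (\<forall>z\<in>ball 0 \<eta>. opnorm_le (X z) s) \<and> mat_holomorphic X (ball 0 \<eta>) \<and>
      (\<forall>t S. \<bar>t - t1\<bar> < \<eta> \<longrightarrow> ((\<lambda>t. X (complex_of_real (t - t1))) has_vector_derivative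
         ricci_field x y T (X (complex_of_real (t - t1)))) (at t within S))"
    using local_solution[OF r(1) s(2,3)] by blast
  show ?thesis
  proof (rule that[of "\<eta> / 2"])
    fix t1 c assume "t0 \<le> t1" and c: "flow {t0..t1} c"
    have t1: "t1 \<in> {t0..t1}" using \<open>t0 \<le> t1\<close> by simp
    let ?S = "{t1..t1 + \<eta> / 2}"
    from loc[OF bd[OF c t1], of t1] obtain X where X: "X 0 = coord (c t1)"
        "\<And>z. z \<in> ball 0 \<eta> \<Longrightarrow> opnorm_le (X z) s"
        "\<And>t S. \<bar>t - t1\<bar> < \<eta> \<Longrightarrow> ((\<lambda>t. X (complex_of_real (t - t1))) has_vector_derivative
         ricci_field x y T (X (complex_of_real (t - t1)))) (at t within S)" by blast
    define Y where "Y t = X (complex_of_real (t - t1))" for t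
    have near: "\<bar>t - t1\<bar> < \<eta>" if "t \<in> ?S" for t using that \<eta> by auto
    have Y_bd: "opnorm_le (Y t) s" if "t \<in> ?S" for t
      unfolding Y_def using near[OF that] by (intro X(2)) (simp del: of_real_diff)
    have Y_der: "(Y has_vector_derivative ricci_field x y T (Y t)) (at t within ?S)" if "t \<in> ?S" for t
      unfolding Y_def[abs_def] using X(3)[OF near[OF that]] by simp
    have Y1: "Y t1 = coord (c t1)" by (simp add: Y_def X(1))
    have Y_herm: "hermitian (Y t)" if "t \<in> ?S" for t
      by (rule ricci_field_solution_hermitian[OF Y_der Y_bd s(1,3) _ that])
        (simp_all add: Y1 contractive_hermitian flow_coord(1)[OF c t1])
    define d where "d t = T *\<^sub>R (mat 1 - Y t)" for t
    have d: "d t \<in> posdef_set" "(d has_vector_derivative - lap x y (mlog (d t))) (at t within ?S)"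
      if "t \<in> ?S" for t
      unfolding d_def[abs_def]
      using flow_derivative_of_coord[OF Y_der[OF that] Y_herm[OF that] Y_bd[OF that] s(3)] by simp_all
    have d1: "d t1 = c t1" by (simp add: d_def Y1 coord_inverse)
    \<comment> \<open>The pieces fit together in a differentiable way at \<open>t1\<close>: they
      have the same value there, and the equation turns equal values into equal one-sided
      derivatives.\<close>
    define c' where "c' t = (if t \<in> {t0..t1} then c t else d t)" for t
    have "flow {t0..t1 + \<eta> / 2} c'"
      unfolding flow_def
    proof (intro conjI ballI)
      show "c' t0 = c0" using c \<open>t0 \<le> t1\<close> by (simp add: c'_def flow_def)
      fix t assume t: "t \<in> {t0..t1 + \<eta> / 2}"
      show "c' t \<in> posdef_set"
        using c d(1) t by (auto simp: c'_def flow_def)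
      have un: "{t0..t1 + \<eta> / 2} = {t0..t1} \<union> ?S" using \<open>t0 \<le> t1\<close> \<eta> by auto
      have "(c' has_vector_derivative
          (if t \<in> {t0..t1} then - lap x y (mlog (c t)) else - lap x y (mlog (d t))))
          (at t within {t0..t1 + \<eta> / 2})"
        unfolding c'_def[abs_def]
      proof (rule has_vector_derivative_If_within_closures[OF _ un,
            where f' = "\<lambda>t. - lap x y (mlog (c t))" and g' = "\<lambda>t. - lap x y (mlog (d t))"])
        have cl: "closure {t0..t1} \<inter> closure ?S = {t1}" using \<open>t0 \<le> t1\<close> \<eta> by auto
        have s1: "{t0..t1} \<union> closure {t0..t1} \<inter> closure ?S = {t0..t1}" unfolding cl using \<open>t0 \<le> t1\<close> by auto
        have s2: "?S \<union> closure {t0..t1} \<inter> closure ?S = ?S" unfolding cl using \<eta> by auto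
        show "(c has_vector_derivative - lap x y (mlog (c t)))
            (at t within {t0..t1} \<union> closure {t0..t1} \<inter> closure ?S)"
          if "t \<in> {t0..t1} \<union> closure {t0..t1} \<inter> closure ?S"
          using that c unfolding s1 by (simp add: flow_def)
        show "(d has_vector_derivative - lap x y (mlog (d t)))
            (at t within ?S \<union> closure {t0..t1} \<inter> closure ?S)"
          if "t \<in> ?S \<union> closure {t0..t1} \<inter> closure ?S"
          using that unfolding s2 by (rule d(2))
        show "c t = d t" if "t \<in> closure {t0..t1}" "t \<in> closure ?S"
          using that cl d1 by auto
        show "- lap x y (mlog (c t)) = - lap x y (mlog (d t))" if "t \<in> closure {t0..t1}" "t \<in> closure ?S"
          using that cl d1 by auto
        show "t \<in> {t0..t1} \<union> ?S" using t un by blast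
      qed
      moreover have "(if t \<in> {t0..t1} then - lap x y (mlog (c t)) else - lap x y (mlog (d t)))
          = - lap x y (mlog (c' t))" by (simp add: c'_def)
      ultimately show "(c' has_vector_derivative - lap x y (mlog (c' t))) (at t within {t0..t1 + \<eta> / 2})"
        by (simp only:)
    qed
    then show "\<exists>c'. flow {t0..t1 + \<eta> / 2} c'" by blast
  qed (use \<eta> in simp)
qed

lemma flow_exists: "\<exists>c. flow {t0..t1} c"
proof -
  obtain \<epsilon> where \<epsilon>: "\<epsilon> > 0" and ext: "\<And>t1 c. t0 \<le> t1 \<Longrightarrow> flow {t0..t1} c \<Longrightarrow> \<exists>c'. flow {t0..t1 + \<epsilon>} c'"
    using flow_extend by blast
  have "\<exists>c. flow {t0..t0 + real n * \<epsilon>} c" for n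
  proof (induction n)
    case 0
    \<comment> \<open>On the one-point interval the filter is trivial, so the constant function has
      every derivative, in particular the one prescribed by the equation.\<close>
    have "at t0 within {t0} = bot" by (simp add: at_within_def)
    then have "((\<lambda>_. c0) has_vector_derivative D) (at t0 within {t0})" for D
      by (simp add: has_vector_derivative_def has_derivative_def bounded_linear_scaleR_left)
    then have "flow {t0..t0} (\<lambda>_. c0)" by (simp add: flow_def c0)
    then show ?case by auto
  next
    case (Suc n)
    then obtain c where "flow {t0..t0 + real n * \<epsilon>} c" by blast
    from ext[OF _ this] \<epsilon> show ?case by (simp add: algebra_simps)
  qed
  moreover obtain n where "t1 - t0 \<le> real n * \<epsilon>"
    using \<epsilon> by (metis reals_Archimedean3 less_imp_le)
  ultimately show ?thesis
    using flow_subset[of "{t0..t0 + real n * \<epsilon>}" _ "{t0..t1}"] by auto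
qed

text \<open>Solutions on bounded intervals agree on overlaps by uniqueness, so evaluating at
  \<open>t\<close> the solution that ends at \<open>t\<close> defines one function on the
  half-line.\<close>

lemma flow_exists_global: "\<exists>c. flow {t0..} c"
proof -
  obtain sol where sol: "\<And>t1. flow {t0..t1} (sol t1)" using flow_exists by metis
  define c where "c t = sol t t" for t
  have c_eq: "c t = sol t1 t" if "t \<in> {t0..t1}" for t t1
    unfolding c_def
    by (rule flow_unique[OF sol[of t] flow_subset[OF sol[of t1]]]) (use that in auto)
  have "flow {t0..} c"
    unfolding flow_def
  proof (intro conjI ballI)
    show "c t0 = c0" using sol[of t0] by (simp add: c_def flow_def)
    fix t assume t: "t \<in> {t0..}"
    \<comment> \<open>An end time beyond \<open>t\<close> makes the derivative within the bounded
      interval the same as the one within the half-line.\<close>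
    define t1 where "t1 = t + 1"
    have ct: "c t = sol t1 t" using t by (intro c_eq) (simp add: t1_def)
    have t': "t \<in> {t0..t1}" using t by (simp add: t1_def)
    then show "c t \<in> posdef_set" using sol[of t1] by (simp add: flow_def ct)
    have "(sol t1 has_vector_derivative - lap x y (mlog (c t))) (at t within {t0..t1})"
      using sol[of t1] t' by (simp add: flow_def ct)
    then have "(c has_vector_derivative - lap x y (mlog (c t))) (at t within {t0..t1})"
      by (rule has_vector_derivative_transform[OF t' c_eq, rotated])
    moreover have "at t within {t0..t1} = at t within {t0..}"
      by (rule at_within_nhd[of _ "{..<t1}"]) (auto simp: t1_def)
    ultimately show "(c has_vector_derivative - lap x y (mlog (c t))) (at t within {t0..})" by simp
  qed
  then show ?thesis by blast
qed

section \<open>Analyticity and equivalence with the original notion of solution\<close>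

lemma flow_analytic:
  assumes c: "flow {t0..} c" and "t2 \<ge> t0"
  shows "\<exists>\<epsilon>>0. \<forall>i j. \<exists>a :: nat \<Rightarrow> complex. \<forall>t\<in>{t0..}. \<bar>t - t2\<bar> < \<epsilon> \<longrightarrow>
    (\<lambda>k. a k * complex_of_real (t - t2) ^ k) sums (c t $ i $ j)"
proof -
  obtain r where r: "0 \<le> r" "r < 1"
    and bd: "\<And>t1 c t. flow {t0..t1} c \<Longrightarrow> t \<in> {t0..t1} \<Longrightarrow> opnorm_le (coord (c t)) r"
    using flow_uniform_bound by blast
  define s where "s = (r + 1) / 2"
  have s: "0 \<le> s" "r < s" "s < 1" using r by (simp_all add: s_def)
  obtain \<eta> where \<eta>: "\<eta> > 0"
    and loc: "\<And>X0 t1. opnorm_le X0 r \<Longrightarrow> \<exists>X. X 0 = X0 \<and>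
      (\<forall>z\<in>ball 0 \<eta>. opnorm_le (X z) s) \<and> mat_holomorphic X (ball 0 \<eta>) \<and>
      (\<forall>t S. \<bar>t - t1\<bar> < \<eta> \<longrightarrow> ((\<lambda>t. X (complex_of_real (t - t1))) has_vector_derivative
         ricci_field x y T (X (complex_of_real (t - t1)))) (at t within S))"
    using local_solution[OF r(1) s(2,3)] by blast
  obtain L where lip: "\<And>X Y. opnorm_le X s \<Longrightarrow> opnorm_le Y s \<Longrightarrow>
       norm (ricci_field x y T X - ricci_field x y T Y) \<le> L * norm (X - Y)"
    using ricci_field_lipschitz[OF s(1,3)] by blast
  \<comment> \<open>Starting the holomorphic solution slightly before \<open>t2\<close> makes forward uniqueness suffice.\<close>
  define t1 where "t1 = max t0 (t2 - \<eta> / 2)"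
  have t1: "t0 \<le> t1" "t1 \<le> t2" "t2 - t1 \<le> \<eta> / 2" using \<open>t2 \<ge> t0\<close> \<eta> by (auto simp: t1_def max_def)
  have cb: "flow {t0..b} c" for b by (rule flow_subset[OF c]) auto
  from loc[OF bd[OF cb[of t1], of t1], of t1] t1 obtain X where X: "X 0 = coord (c t1)"
        "\<And>z. z \<in> ball 0 \<eta> \<Longrightarrow> opnorm_le (X z) s" "mat_holomorphic X (ball 0 \<eta>)"
        "\<And>t S. \<bar>t - t1\<bar> < \<eta> \<Longrightarrow> ((\<lambda>t. X (complex_of_real (t - t1))) has_vector_derivative
         ricci_field x y T (X (complex_of_real (t - t1)))) (at t within S)" by auto
  have cX: "coord (c t) = X (complex_of_real (t - t1))" if t: "t1 \<le> t" "t < t1 + \<eta>" for t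
  proof (rule ode_unique_forward[where a = t1 and b = t and K = "{X. opnorm_le X s}"
        and F = "ricci_field x y T" and L = L and X = "\<lambda>t. coord (c t)"
        and Y = "\<lambda>t. X (complex_of_real (t - t1))"])
    fix u assume u: "u \<in> {t1..t}"
    then have u0: "u \<in> {t0..t}" using t1 by auto
    show "((\<lambda>t. coord (c t)) has_vector_derivative ricci_field x y T (coord (c u))) (at u within {t1..t})"
      by (rule has_vector_derivative_within_subset[OF flow_coord(2)[OF cb u0]]) (use t1 in auto)
    have near: "\<bar>u - t1\<bar> < \<eta>" using u t by auto
    then show "((\<lambda>t. X (complex_of_real (t - t1))) has_vector_derivative
         ricci_field x y T (X (complex_of_real (u - t1)))) (at u within {t1..t})" by (rule X(4))
    show "coord (c u) \<in> {X. opnorm_le X s}"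
      using bd[OF cb u0] s(2) by (auto elim: opnorm_le_mono)
    show "X (complex_of_real (u - t1)) \<in> {X. opnorm_le X s}"
      using near X(2) by (simp del: of_real_diff)
  qed (use lip X(1) t in auto)
  show ?thesis
  proof (intro exI[of _ "\<eta> / 2"] conjI allI)
    show "\<eta> / 2 > 0" using \<eta> by simp
    fix i j
    \<comment> \<open>An entry of the metric in complex time, recentred at \<open>t2\<close>. As
      \<open>t2 - t1\<close> is at most \<open>\<eta> / 2\<close>, the disc of radius
      \<open>\<eta> / 2\<close> around \<open>t2\<close> lies in the disc where \<open>X\<close> is
      holomorphic.\<close>
    define h where "h z = T * (mat 1 $ i $ j - X (z + of_real (t2 - t1)) $ i $ j)" for z
    have "h holomorphic_on ball 0 (\<eta> / 2)"
    proof -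
      have "(\<lambda>w. X w $ i $ j) \<circ> (\<lambda>z. z + complex_of_real (t2 - t1)) holomorphic_on ball 0 (\<eta> / 2)"
      proof (rule holomorphic_on_compose_gen[where t = "ball 0 \<eta>"])
        show "(\<lambda>w. X w $ i $ j) holomorphic_on ball 0 \<eta>"
          using X(3) by (simp add: mat_holomorphic_def)
        show "(\<lambda>z. z + complex_of_real (t2 - t1)) ` ball 0 (\<eta> / 2) \<subseteq> ball 0 \<eta>"
        proof (rule image_subsetI)
          fix z :: complex assume "z \<in> ball 0 (\<eta> / 2)"
          then show "z + of_real (t2 - t1) \<in> ball 0 \<eta>"
            using norm_triangle_ineq[of z "of_real (t2 - t1)"] t1
            by (simp del: of_real_diff)
        qed
      qed (intro holomorphic_intros)
      then show ?thesis unfolding h_def o_def by (intro holomorphic_intros)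
    qed
    then have sums: "(\<lambda>k. (deriv ^^ k) h 0 / fact k * (w - 0) ^ k) sums h w" if "w \<in> ball 0 (\<eta> / 2)" for w
      using that by (rule holomorphic_power_series)
    show "\<exists>a. \<forall>t\<in>{t0..}. \<bar>t - t2\<bar> < \<eta> / 2 \<longrightarrow>
      (\<lambda>k. a k * complex_of_real (t - t2) ^ k) sums (c t $ i $ j)"
    proof (intro exI[of _ "\<lambda>k. (deriv ^^ k) h 0 / fact k"] ballI impI)
      fix t assume t: "t \<in> {t0..}" "\<bar>t - t2\<bar> < \<eta> / 2"
      \<comment> \<open>The definition of \<open>t1\<close> as a maximum is used here: a time that
        is at least \<open>t0\<close> and within \<open>\<eta> / 2\<close> of \<open>t2\<close>
        cannot precede \<open>t1\<close>.\<close>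
      then have "t1 \<le> t" "t < t1 + \<eta>" by (auto simp: t1_def max_def abs_if split: if_splits)
      then have "c t = T *\<^sub>R (mat 1 - X (complex_of_real (t - t1)))"
        using cX[of t] coord_inverse[of "c t"] by simp
      moreover have "complex_of_real (t - t2) + of_real (t2 - t1) = of_real (t - t1)" by simp
      ultimately have "c t $ i $ j = h (of_real (t - t2))"
        by (simp only: h_def) (simp add: scaleR_conv_of_real[where 'a=complex])
      with sums[of "of_real (t - t2)"] t(2)
      show "(\<lambda>k. (deriv ^^ k) h 0 / fact k * complex_of_real (t - t2) ^ k) sums (c t $ i $ j)"
        by (simp del: of_real_diff)
    qed
  qed
qed

lemma ricci_sol_imp_flow: "ricci_sol x y t0 S c0 c \<Longrightarrow> flow S c"
  unfolding ricci_sol_def flow_def has_vector_derivative_matrix_iff by auto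

text \<open>Continuity of the derivative follows from the equation: by the a priori bound it is a
  Lipschitz field evaluated along a continuous curve. The condition on \<open>S\<close> covers
  compact intervals from \<open>t0\<close> and the half-line at once.\<close>

lemma flow_imp_ricci_sol:
  assumes c: "flow S c" and S: "\<And>t. t \<in> S \<Longrightarrow> t0 \<le> t \<and> {t0..t} \<subseteq> S"
  shows "ricci_sol x y t0 S c0 c"
proof -
  obtain r where r: "0 \<le> r" "r < 1"
    and bd: "\<And>t1 c t. flow {t0..t1} c \<Longrightarrow> t \<in> {t0..t1} \<Longrightarrow> opnorm_le (coord (c t)) r"
    using flow_uniform_bound by blast
  obtain L where L: "L \<ge> 0" and lip: "\<And>X Y. opnorm_le X r \<Longrightarrow> opnorm_le Y r \<Longrightarrow>
       norm (ricci_field x y T X - ricci_field x y T Y) \<le> L * norm (X - Y)"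
    using ricci_field_lipschitz[OF r] by blast
  have S_bd: "opnorm_le (coord (c t)) r" "contractive (coord (c t))" if "t \<in> S" for t
    using bd[of t c t] flow_coord(1)[of t c t] flow_subset[OF c] S[OF that] by auto
  have eq: "- lap x y (mlog (c t)) = (- T) *\<^sub>R ricci_field x y T (coord (c t))" if "t \<in> S" for t
    using posdef_of_opnorm(2)[OF contractive_hermitian[OF S_bd(2)[OF that]] S_bd(1)[OF that] r(2) T_pos] T_pos
    by (simp add: coord_inverse ricci_field_def
        linear_diff[OF bounded_linear.linear[OF bounded_linear_lap]] lap_scalar)
  have "continuous_on {X. opnorm_le X r} (ricci_field x y T)"
    by (rule lipschitz_on_continuous_on[where L = L], rule lipschitz_onI)
      (use lip L in \<open>auto simp: dist_norm\<close>)
  moreover have "continuous_on S c"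
    using c by (auto simp: flow_def continuous_on_eq_continuous_within
        intro: has_vector_derivative_continuous)
  then have "continuous_on S (\<lambda>t. coord (c t))"
    unfolding coord_def by (intro continuous_intros)
  ultimately have "continuous_on S (\<lambda>t. ricci_field x y T (coord (c t)))"
    by (rule continuous_on_compose2) (use S_bd in auto)
  then have "continuous_on S (\<lambda>t. (- T) *\<^sub>R ricci_field x y T (coord (c t)))"
    by (intro continuous_intros)
  then have cont: "continuous_on S (\<lambda>t. - lap x y (mlog (c t)))"
    using eq by (simp cong: continuous_on_cong)
  show ?thesis
    unfolding ricci_sol_def
  proof (intro conjI exI[of _ "\<lambda>t. - lap x y (mlog (c t))"] allI ballI)
    show "continuous_on S (\<lambda>t. (- lap x y (mlog (c t))) $ i $ j)" for i j
      by (intro bounded_linear.continuous_on[OF bounded_linear_compose[OF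
          bounded_linear_vec_nth bounded_linear_vec_nth]] cont)
  qed (use c in \<open>auto simp: flow_def has_vector_derivative_matrix_iff\<close>)
qed

end

theorem theorem3p1:
  fixes u v x y c0 :: "complex^'n^'n" and m :: nat and t0 :: real
  assumes "CARD('n) \<ge> 2" and "1 \<le> m" and "m < CARD('n)" and "coprime m CARD('n)"
    and "unitary u" and "unitary v" and "generates u v"
    and "v ** u = cscale (exp (2 * pi * \<i> * of_nat m / of_nat CARD('n))) (u ** v)"
    and "hermitian x" and "hermitian y"
    and "u = mexp (cscale (2 * pi * \<i> / of_nat CARD('n)) x)"
    and "v = mexp (cscale (2 * pi * \<i> / of_nat CARD('n)) y)"
    and "c0 \<in> posdef_set"
  shows "(\<forall>t1 \<ge> t0. (\<exists>c. ricci_sol x y t0 {t0..t1} c0 c) \<and>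
            (\<forall>c1 c2. ricci_sol x y t0 {t0..t1} c0 c1 \<and> ricci_sol x y t0 {t0..t1} c0 c2
                 \<longrightarrow> (\<forall>t\<in>{t0..t1}. c1 t = c2 t)))
       \<and> (\<exists>c. ricci_sol x y t0 {t0..} c0 c)
       \<and> (\<forall>c1 c2. ricci_sol x y t0 {t0..} c0 c1 \<and> ricci_sol x y t0 {t0..} c0 c2
                 \<longrightarrow> (\<forall>t\<in>{t0..}. c1 t = c2 t))
       \<and> (\<forall>c. ricci_sol x y t0 {t0..} c0 c \<longrightarrow>
            (\<forall>t2 \<ge> t0. \<exists>\<epsilon>>0. \<forall>i j. \<exists>a :: nat \<Rightarrow> complex.
               \<forall>t\<in>{t0..}. \<bar>t - t2\<bar> < \<epsilon> \<longrightarrow>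
                 (\<lambda>k. a k * complex_of_real (t - t2) ^ k) sums (c t $ i $ j)))"
proof -
  interpret ricci_flow x y c0 t0
    by unfold_locales fact+
  have ex: "\<exists>c. ricci_sol x y t0 {t0..t1} c0 c" for t1
    using flow_exists[of t1] flow_imp_ricci_sol[of "{t0..t1}"] by fastforce
  have uniq: "c1 t = c2 t" if "ricci_sol x y t0 {t0..t1} c0 c1" "ricci_sol x y t0 {t0..t1} c0 c2"
    "t \<in> {t0..t1}" for t1 c1 c2 t
    using flow_unique ricci_sol_imp_flow that by blast
  have ex_global: "\<exists>c. ricci_sol x y t0 {t0..} c0 c"
    using flow_exists_global flow_imp_ricci_sol[of "{t0..}"] by fastforce
  have uniq_global: "c1 t = c2 t" if "ricci_sol x y t0 {t0..} c0 c1" "ricci_sol x y t0 {t0..} c0 c2"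
    "t \<in> {t0..}" for c1 c2 t
    by (rule flow_unique[of t]; (rule flow_subset[OF ricci_sol_imp_flow])?) (use that in auto)
  show ?thesis
    using ex uniq ex_global uniq_global flow_analytic[OF ricci_sol_imp_flow] by blast
qed

end
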